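(* Let $V$ be a quasi-vertex operator algebra, $\Gamma\subset\mathrm{PSL}_2(\mathbb R)$ any Fuchsian group of the first kind, and $\mathcal V_X$ the associated bundle on $X=\Gamma\backslash\overline{\mathbb H}$. Then $$\nabla:=d+L(-1)\otimes d\tau$$ defines a connection $\nabla:\mathcal V_X\to\mathcal V_X\otimes\Omega^1_X$ on $\mathcal V_X$.
   Context: QVOA: a quasi-vertex operator algebra is a $\mathbb Z$-graded vertex algebra $V=\bigoplus_n V_n$ (vertex operators $Y$, vacuum $\mathbf 1$) with $\dim V_n<\infty$ and $V_n=0$ for $n\ll0$, together with operators $L(-1),L(0),L(1)$ satisfying $[L(m),L(n)]=(m-n)L(m+n)$, where $L(-1)$ is the canonical derivation, $L(0)$ acts on $V_n$ as multiplication by $n$ and $[L(1),Y(u,z)]=Y((L(1)+2zL(0)+z^2L(-1))u,z)$. $F_NV=\bigoplus_{n\le N}V_n$. For $\gamma=\begin{pmatrix}a&b\\c&d\end{pmatrix}\in\mathrm{SL}_2(\mathbb R)$, $j(\gamma,\tau)=c\tau+d$ and $K(\gamma,\tau)=e^{-c\,j(\gamma,\tau)L(1)}j(\gamma,\tau)^{-2L(0)}\in\mathrm{End}(V)$; this satisfies $K(\gamma\beta,\tau)=K(\gamma,\beta\tau)K(\beta,\tau)$. A Fuchsian group of the first kind $\Gamma$ is a finitely generated discrete subgroup of $\mathrm{PSL}_2(\mathbb R)$ of finite hyperbolic covolume; its elements are lifted to $\mathrm{SL}_2(\mathbb R)$; $\overline{\mathbb H}=\mathbb H\cup\{\text{cusps}\}$.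 Bundles on $X$ are understood as orbifold bundles, i.e. as data of $\Gamma$-automorphy factors on $\mathbb H$, with regularity at a cusp $s=\sigma\infty$ ($\sigma\in\mathrm{SL}_2(\mathbb R)$) expressed by holomorphic expansions in $q_\lambda=e^{2\pi i\tau/\lambda}$ ($\lambda$ the cusp width), after transport by $\sigma$. $\mathcal V_X$ is the quotient of $\mathbb H\times V$ by $\gamma(\tau,v)=(\gamma\tau,K(\gamma,\tau)v)$, extended over the cusps: its local sections are holomorphic $f$ with values in some $F_NV$ such that $f(\gamma\tau)=K(\gamma,\tau)f(\tau)$. Under the same convention $\Omega^1_X=K_X$ corresponds to the automorphy factor $j(\gamma,\tau)^2$, so local sections of $\mathcal V_X\otimes\Omega^1_X$ are $g\,d\tau$ with $g(\gamma\tau)=j(\gamma,\tau)^2K(\gamma,\tau)g(\tau)$. Explicitly $\nabla f=\big(\tfrac{df}{d\tau}+L(-1)f\big)d\tau$ (with values in $F_{N+1}V$ when $f$ has values in $F_NV$). *)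

theory Defs
  imports "HOL-Analysis.Analysis" "HOL-Algebra.Generated_Groups"
begin

section \<open>Quasi-vertex operator algebras\<close>

text \<open>
  The modes \<open>u\<^sub>n = Y u n\<close> are normalised by \<open>Y(u,z) = (\<Sum>n. u\<^sub>n z\<^bsup>-n-1\<^esup>)\<close>.
  The axioms are creation, translation covariance (for the canonical derivation
  \<open>u \<mapsto> u\<^bsub>-2\<^esub> vac\<close>) and locality; \<open>locality\<close> is the coefficient of
  \<open>z\<^sub>1\<^bsup>-m-1\<^esup> z\<^sub>2\<^bsup>-n-1\<^esup>\<close> in \<open>(z\<^sub>1 - z\<^sub>2)\<^bsup>N\<^esup> [Y(u,z\<^sub>1), Y(v,z\<^sub>2)] = 0\<close>.
\<close>

locale vertex_algebra = vector_space smul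
  for smul :: "complex \<Rightarrow> 'v::ab_group_add \<Rightarrow> 'v" +
  fixes Y :: "'v \<Rightarrow> int \<Rightarrow> 'v \<Rightarrow> 'v" and vac :: 'v
  assumes linear_state: "Vector_Spaces.linear smul smul (\<lambda>u. Y u n w)"
    and linear_mode: "Vector_Spaces.linear smul smul (Y u n)"
    and truncation: "\<exists>N. \<forall>n\<ge>N. Y u n w = 0"
    and vacuum: "Y vac n w = (if n = -1 then w else 0)"
    and creation: "Y u (-1) vac = u" "n \<ge> 0 \<Longrightarrow> Y u n vac = 0"
    and translation: "Y (Y u n w) (-2) vac - Y u n (Y w (-2) vac) = smul (- of_int n) (Y u (n - 1) w)"
    and locality: "\<exists>N::nat. \<forall>m n w.
       (\<Sum>i\<le>N. smul ((-1) ^ i * of_nat (N choose i))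
          (Y u (m + int N - int i) (Y v (n + int i) w)
           - Y v (n + int i) (Y u (m + int N - int i) w))) = 0"

definition decomposes :: "(int \<Rightarrow> 'v::ab_group_add set) \<Rightarrow> (int \<Rightarrow> 'v) \<Rightarrow> 'v \<Rightarrow> bool" where
  "decomposes V c v \<longleftrightarrow>
     (\<forall>n. c n \<in> V n) \<and> finite {n. c n \<noteq> 0} \<and> v = (\<Sum>n | c n \<noteq> 0. c n)"

locale graded_vertex_algebra = vertex_algebra smul Y vac
  for smul :: "complex \<Rightarrow> 'v::ab_group_add \<Rightarrow> 'v" and Y vac +
  fixes V :: "int \<Rightarrow> 'v set"
  assumes subspace_grade: "subspace (V n)"
    and direct_sum: "\<exists>!c. decomposes V c v"
    and vac_grade: "vac \<in> V 0"
    and mode_grade: "u \<in> V k \<Longrightarrow> w \<in> V m \<Longrightarrow> Y u n w \<in> V (m + k - n - 1)"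

text \<open>
  Only \<open>L (-1)\<close>, \<open>L 0\<close>, \<open>L 1\<close> are meaningful. \<open>L1_vertex\<close> is the coefficient of
  \<open>z\<^bsup>-n-1\<^esup>\<close> in \<open>[L(1), Y(u,z)] = Y((L(1) + 2 z L(0) + z\<^sup>2 L(-1)) u, z)\<close>.
\<close>

locale qvoa = graded_vertex_algebra smul Y vac V
  for smul :: "complex \<Rightarrow> 'v::ab_group_add \<Rightarrow> 'v" and Y vac V +
  fixes L :: "int \<Rightarrow> 'v \<Rightarrow> 'v"
  assumes finite_dim_grade: "\<exists>B. finite B \<and> V n = span B"
    and bounded_below: "\<exists>n0. \<forall>n<n0. V n = {0}"
    and linear_L: "m \<in> {-1..1} \<Longrightarrow> Vector_Spaces.linear smul smul (L m)"
    and sl2: "m \<in> {-1..1} \<Longrightarrow> n \<in> {-1..1} \<Longrightarrow>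
       L m (L n v) - L n (L m v) = smul (of_int (m - n)) (L (m + n) v)"
    and Lm1_derivation: "L (-1) u = Y u (-2) vac"
    and L0_grade: "u \<in> V n \<Longrightarrow> L 0 u = smul (of_int n) u"
    and L1_vertex: "L 1 (Y u n w) - Y u n (L 1 w) =
       Y (L 1 u) n w + smul 2 (Y (L 0 u) (n + 1) w) + Y (L (-1) u) (n + 2) w"

definition filtr ::
  "(complex \<Rightarrow> 'v::ab_group_add \<Rightarrow> 'v) \<Rightarrow> (int \<Rightarrow> 'v set) \<Rightarrow> int \<Rightarrow> 'v set" where
  "filtr smul V N = module.span smul (\<Union>n\<in>{..N}. V n)"

definition component :: "(int \<Rightarrow> 'v::ab_group_add set) \<Rightarrow> int \<Rightarrow> 'v \<Rightarrow> 'v" where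
  "component V n v = (THE c. decomposes V c v) n"

text \<open>\<open>pow_L0 smul V x k\<close> is \<open>x\<^bsup>k L(0)\<^esup>\<close>.\<close>

definition pow_L0 :: "(complex \<Rightarrow> 'v::ab_group_add \<Rightarrow> 'v) \<Rightarrow> (int \<Rightarrow> 'v set) \<Rightarrow>
    complex \<Rightarrow> int \<Rightarrow> 'v \<Rightarrow> 'v" where
  "pow_L0 smul V x k v =
     (\<Sum>n | component V n v \<noteq> 0. smul (x powi (k * n)) (component V n v))"

text \<open>
  The exponential series of a locally nilpotent operator, such as \<open>L(1)\<close>, which
  lowers degrees by one.
\<close>

definition exp_op :: "(complex \<Rightarrow> 'v::ab_group_add \<Rightarrow> 'v) \<Rightarrow> complex \<Rightarrow> ('v \<Rightarrow> 'v) \<Rightarrow> 'v \<Rightarrow> 'v" where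
  "exp_op smul x A v = (\<Sum>k | (A ^^ k) v \<noteq> 0. smul (x ^ k / fact k) ((A ^^ k) v))"


section \<open>Fuchsian groups\<close>

definition SL2R :: "(real^2^2) monoid" where
  "SL2R = \<lparr>carrier = {\<gamma>. det \<gamma> = 1}, mult = (**), one = mat 1\<rparr>"

definition PSL2R :: "(real^2^2) set monoid" where
  "PSL2R = SL2R Mod {mat 1, - mat 1}"

definition moebius :: "real^2^2 \<Rightarrow> complex \<Rightarrow> complex" where
  "moebius \<gamma> \<tau> = (of_real (\<gamma>$1$1) * \<tau> + of_real (\<gamma>$1$2)) / (of_real (\<gamma>$2$1) * \<tau> + of_real (\<gamma>$2$2))"

text \<open>The action on the Riemann sphere, with \<open>None\<close> as the point at infinity.\<close>

fun moebius_sphere :: "real^2^2 \<Rightarrow> complex option \<Rightarrow> complex option" where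
  "moebius_sphere \<gamma> (Some z) =
     (if of_real (\<gamma>$2$1) * z + of_real (\<gamma>$2$2) = 0 then None else Some (moebius \<gamma> z))"
| "moebius_sphere \<gamma> None =
     (if \<gamma>$2$1 = 0 then None else Some (of_real (\<gamma>$1$1 / \<gamma>$2$1)))"

definition upper_half_plane :: "complex set" where
  "upper_half_plane = {\<tau>. Im \<tau> > 0}"

text \<open>
  An element of \<open>PSL2R\<close> is the set of its two lifts, so \<open>\<Union>\<Gamma>\<close> consists of all lifts
  of elements of \<open>\<Gamma>\<close>. As the kernel is finite, \<open>\<Gamma>\<close> is discrete iff \<open>\<Union>\<Gamma>\<close> is a
  discrete set of matrices. The covolume is the area of a measurable strict
  fundamental domain with respect to \<open>dx dy / y\<^sup>2\<close>.
\<close>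

definition fuchsian_first_kind :: "(real^2^2) set set \<Rightarrow> bool" where
  "fuchsian_first_kind \<Gamma> \<longleftrightarrow>
     subgroup \<Gamma> PSL2R \<and>
     (\<exists>S. finite S \<and> S \<subseteq> carrier PSL2R \<and> \<Gamma> = generate PSL2R S) \<and>
     discrete (\<Union>\<Gamma>) \<and>
     (\<exists>D\<in>sets borel. D \<subseteq> upper_half_plane \<and>
        (\<forall>\<tau>\<in>upper_half_plane. \<exists>!\<tau>'. \<tau>' \<in> D \<and> (\<exists>\<gamma>\<in>\<Union>\<Gamma>. \<tau>' = moebius \<gamma> \<tau>)) \<and>
        (\<integral>\<^sup>+\<tau>\<in>D. ennreal (1 / (Im \<tau>)\<^sup>2) \<partial>lborel) < \<infinity>)"

definition cusps :: "(real^2^2) set set \<Rightarrow> complex option set" where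
  "cusps \<Gamma> = {s \<in> insert None (Some ` \<real>).
     \<exists>\<gamma>\<in>\<Union>\<Gamma>. \<gamma> \<noteq> mat 1 \<and> \<gamma> \<noteq> - mat 1 \<and> \<bar>trace \<gamma>\<bar> = 2 \<and> moebius_sphere \<gamma> s = s}"

definition extended_half_plane :: "(real^2^2) set set \<Rightarrow> complex option set" where
  "extended_half_plane \<Gamma> = Some ` upper_half_plane \<union> cusps \<Gamma>"

text \<open>The horoball topology; \<open>\<sigma>\<infinity> \<in> W\<close> forces \<open>\<sigma>\<infinity>\<close> to be a cusp.\<close>

definition extended_half_plane_open :: "(real^2^2) set set \<Rightarrow> complex option set \<Rightarrow> bool" where
  "extended_half_plane_open \<Gamma> W \<longleftrightarrow>
     W \<subseteq> extended_half_plane \<Gamma> \<and>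
     open {\<tau> \<in> upper_half_plane. Some \<tau> \<in> W} \<and>
     (\<forall>\<sigma>. det \<sigma> = 1 \<longrightarrow> moebius_sphere \<sigma> None \<in> W \<longrightarrow>
        (\<exists>C>0. \<forall>\<tau>. Im \<tau> > C \<longrightarrow> Some (moebius \<sigma> \<tau>) \<in> W))"

definition modular_curve :: "(real^2^2) set set \<Rightarrow> complex option set set" where
  "modular_curve \<Gamma> = (\<lambda>x. (\<lambda>\<gamma>. moebius_sphere \<gamma> x) ` (\<Union>\<Gamma>)) ` extended_half_plane \<Gamma>"

definition curve_open :: "(real^2^2) set set \<Rightarrow> complex option set set \<Rightarrow> bool" where
  "curve_open \<Gamma> U \<longleftrightarrow> U \<subseteq> modular_curve \<Gamma> \<and> extended_half_plane_open \<Gamma> (\<Union>U)"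

text \<open>The part in the upper half plane of the preimage of a subset of the curve.\<close>

definition preim :: "complex option set set \<Rightarrow> complex set" where
  "preim U = {\<tau> \<in> upper_half_plane. Some \<tau> \<in> \<Union>U}"

definition shift_matrix :: "real \<Rightarrow> real^2^2" where
  "shift_matrix t = vector [vector [1, t], vector [0, 1]]"

text \<open>
  \<open>\<omega>\<close> is the width of the cusp \<open>\<sigma>\<infinity>\<close> (relative to \<open>\<sigma>\<close>): the stabiliser of \<open>\<infinity>\<close>
  in \<open>\<sigma>\<^bsup>-1\<^esup>\<Gamma>\<sigma>\<close> is generated in \<open>PSL2R\<close> by translation by \<open>\<omega>\<close>.
\<close>

definition cusp_width :: "(real^2^2) set set \<Rightarrow> real^2^2 \<Rightarrow> real \<Rightarrow> bool" where
  "cusp_width \<Gamma> \<sigma> \<omega> \<longleftrightarrow> \<omega> > 0 \<and>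
     {\<delta>. det \<delta> = 1 \<and> \<sigma> ** \<delta> ** matrix_inv \<sigma> \<in> \<Union>\<Gamma> \<and> moebius_sphere \<delta> None = None} =
     (\<Union>k::int. {shift_matrix (of_int k * \<omega>), - shift_matrix (of_int k * \<omega>)})"

definition qexp :: "real \<Rightarrow> complex \<Rightarrow> complex" where
  "qexp \<omega> \<tau> = exp (2 * of_real pi * \<i> * \<tau> / of_real \<omega>)"


section \<open>Vector-valued holomorphic functions\<close>

text \<open>
  For a finite-dimensional subspace \<open>W\<close>, restrictions of linear functionals to \<open>W\<close>
  are the linear combinations of coordinates; thus the notions below are
  coordinatewise holomorphy and coordinatewise differentiation.
\<close>

definition holo_into :: "(complex \<Rightarrow> 'v::ab_group_add \<Rightarrow> 'v) \<Rightarrow> 'v set \<Rightarrow> complex set \<Rightarrow>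
    (complex \<Rightarrow> 'v) \<Rightarrow> bool" where
  "holo_into smul W S f \<longleftrightarrow> f \<in> S \<rightarrow> W \<and>
     (\<forall>\<phi>. Vector_Spaces.linear smul (*) \<phi> \<longrightarrow> (\<lambda>\<tau>. \<phi> (f \<tau>)) holomorphic_on S)"

definition vderiv :: "(complex \<Rightarrow> 'v::ab_group_add \<Rightarrow> 'v) \<Rightarrow> (complex \<Rightarrow> 'v) \<Rightarrow> complex \<Rightarrow> 'v" where
  "vderiv smul f \<tau> = (THE v. \<forall>\<phi>. Vector_Spaces.linear smul (*) \<phi> \<longrightarrow>
     ((\<lambda>z. \<phi> (f z)) has_field_derivative \<phi> v) (at \<tau>))"


section \<open>Sheaves given by automorphy factors\<close>

definition autj :: "real^2^2 \<Rightarrow> complex \<Rightarrow> complex" where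
  "autj \<gamma> \<tau> = of_real (\<gamma>$2$1) * \<tau> + of_real (\<gamma>$2$2)"

definition autK :: "(complex \<Rightarrow> 'v::ab_group_add \<Rightarrow> 'v) \<Rightarrow> (int \<Rightarrow> 'v set) \<Rightarrow> (int \<Rightarrow> 'v \<Rightarrow> 'v) \<Rightarrow>
    real^2^2 \<Rightarrow> complex \<Rightarrow> 'v \<Rightarrow> 'v" where
  "autK smul V L \<gamma> \<tau> v =
     exp_op smul (- of_real (\<gamma>$2$1) * autj \<gamma> \<tau>) (L 1) (pow_L0 smul V (autj \<gamma> \<tau>) (-2) v)"

text \<open>
  Sections over \<open>U\<close> with values in \<open>W\<close> for the automorphy factor \<open>M\<close>, as functions on
  \<open>preim U\<close>. At a cusp \<open>\<sigma>\<infinity>\<close> the transported function \<open>\<tau> \<mapsto> M(\<sigma>,\<tau>)\<^bsup>-1\<^esup> f(\<sigma>\<tau>)\<close> is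
  required to be \<open>h(q\<^sub>\<omega>)\<close> with \<open>h\<close> holomorphic near \<open>q\<^sub>\<omega> = 0\<close>.
\<close>

definition aut_sections :: "(complex \<Rightarrow> 'v::ab_group_add \<Rightarrow> 'v) \<Rightarrow> 'v set \<Rightarrow>
    (real^2^2 \<Rightarrow> complex \<Rightarrow> 'v \<Rightarrow> 'v) \<Rightarrow> (real^2^2) set set \<Rightarrow>
    complex option set set \<Rightarrow> (complex \<Rightarrow> 'v) set" where
  "aut_sections smul W M \<Gamma> U = {f \<in> extensional (preim U).
     holo_into smul W (preim U) f \<and>
     (\<forall>\<gamma>\<in>\<Union>\<Gamma>. \<forall>\<tau>\<in>preim U. f (moebius \<gamma> \<tau>) = M \<gamma> \<tau> (f \<tau>)) \<and>
     (\<forall>\<sigma> \<omega>. det \<sigma> = 1 \<longrightarrow> moebius_sphere \<sigma> None \<in> \<Union>U \<longrightarrow> cusp_width \<Gamma> \<sigma> \<omega> \<longrightarrow>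
        (\<exists>r>0. \<exists>h. holo_into smul W (ball 0 r) h \<and>
           (\<forall>\<tau>\<in>upper_half_plane. qexp \<omega> \<tau> \<in> ball 0 r \<longrightarrow>
              moebius \<sigma> \<tau> \<in> preim U \<and> f (moebius \<sigma> \<tau>) = M \<sigma> \<tau> (h (qexp \<omega> \<tau>)))))}"

definition structure_sheaf :: "(real^2^2) set set \<Rightarrow> complex option set set \<Rightarrow>
    (complex \<Rightarrow> complex) set" where
  "structure_sheaf \<Gamma> U = aut_sections (*) UNIV (\<lambda>\<gamma> \<tau> x. x) \<Gamma> U"

definition bundle_sections :: "(complex \<Rightarrow> 'v::ab_group_add \<Rightarrow> 'v) \<Rightarrow> (int \<Rightarrow> 'v set) \<Rightarrow>
    (int \<Rightarrow> 'v \<Rightarrow> 'v) \<Rightarrow> (real^2^2) set set \<Rightarrow> complex option set set \<Rightarrow> (complex \<Rightarrow> 'v) set" where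
  "bundle_sections smul V L \<Gamma> U =
     (\<Union>N. aut_sections smul (filtr smul V N) (autK smul V L) \<Gamma> U)"

text \<open>A section \<open>g d\<tau>\<close> of the bundle tensored with \<open>\<Omega>\<^sup>1\<close> is represented by \<open>g\<close>.\<close>

definition bundle_form_sections :: "(complex \<Rightarrow> 'v::ab_group_add \<Rightarrow> 'v) \<Rightarrow> (int \<Rightarrow> 'v set) \<Rightarrow>
    (int \<Rightarrow> 'v \<Rightarrow> 'v) \<Rightarrow> (real^2^2) set set \<Rightarrow> complex option set set \<Rightarrow> (complex \<Rightarrow> 'v) set" where
  "bundle_form_sections smul V L \<Gamma> U =
     (\<Union>N. aut_sections smul (filtr smul V N)
        (\<lambda>\<gamma> \<tau> v. smul ((autj \<gamma> \<tau>)\<^sup>2) (autK smul V L \<gamma> \<tau> v)) \<Gamma> U)"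

text \<open>
  A connection \<open>E \<rightarrow> E \<otimes> \<Omega>\<^sup>1\<close>: a complex-linear morphism of sheaves \<open>D\<close> satisfying the
  Leibniz rule \<open>D(h f) = dh \<otimes> f + h D f\<close>, with forms \<open>g d\<tau>\<close> represented by \<open>g\<close>.
\<close>

definition is_connection :: "(complex \<Rightarrow> 'v::ab_group_add \<Rightarrow> 'v) \<Rightarrow> (real^2^2) set set \<Rightarrow>
    (complex option set set \<Rightarrow> (complex \<Rightarrow> 'v) set) \<Rightarrow>
    (complex option set set \<Rightarrow> (complex \<Rightarrow> 'v) set) \<Rightarrow>
    (complex option set set \<Rightarrow> (complex \<Rightarrow> 'v) \<Rightarrow> complex \<Rightarrow> 'v) \<Rightarrow> bool" where
  "is_connection smul \<Gamma> E E\<Omega> D \<longleftrightarrow> (\<forall>U. curve_open \<Gamma> U \<longrightarrow>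
     D U \<in> E U \<rightarrow> E\<Omega> U \<and>
     (\<forall>U' f. curve_open \<Gamma> U' \<and> U' \<subseteq> U \<and> f \<in> E U \<longrightarrow>
        D U' (restrict f (preim U')) = restrict (D U f) (preim U')) \<and>
     (\<forall>f\<in>E U. \<forall>g\<in>E U.
        D U (\<lambda>\<tau>\<in>preim U. f \<tau> + g \<tau>) = (\<lambda>\<tau>\<in>preim U. D U f \<tau> + D U g \<tau>)) \<and>
     (\<forall>a. \<forall>f\<in>E U.
        D U (\<lambda>\<tau>\<in>preim U. smul a (f \<tau>)) = (\<lambda>\<tau>\<in>preim U. smul a (D U f \<tau>))) \<and>
     (\<forall>h\<in>structure_sheaf \<Gamma> U. \<forall>f\<in>E U.
        D U (\<lambda>\<tau>\<in>preim U. smul (h \<tau>) (f \<tau>)) =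
          (\<lambda>\<tau>\<in>preim U. smul (deriv h \<tau>) (f \<tau>) + smul (h \<tau>) (D U f \<tau>))))"

definition nabla :: "(complex \<Rightarrow> 'v::ab_group_add \<Rightarrow> 'v) \<Rightarrow> (int \<Rightarrow> 'v \<Rightarrow> 'v) \<Rightarrow>
    complex option set set \<Rightarrow> (complex \<Rightarrow> 'v) \<Rightarrow> complex \<Rightarrow> 'v" where
  "nabla smul L U f = (\<lambda>\<tau>\<in>preim U. vderiv smul f \<tau> + L (-1) (f \<tau>))"

end

theory Submission
  imports Defs "HOL-Complex_Analysis.Cauchy_Integral_Formula"
begin

text \<open>
  A holomorphic function with values in a finite-dimensional space has a derivative, and
  differentiation commutes with every linear map. Additivity, \<open>\<complex>\<close>-linearity, the Leibniz rule and
  compatibility with restriction of \<open>\<nabla> = d + L(-1) \<otimes> d\<tau>\<close> are therefore immediate, and \<open>\<nabla>\<close> raises the filtration by one because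
  \<open>L(-1)\<close> raises degrees by one. The content of the theorem is that \<open>\<nabla> f\<close> transforms with the factor
  \<open>j\<^sup>2 K\<close> when \<open>f\<close> transforms with \<open>K\<close>.

  Write \<open>K = exp(-c j L(1)) j\<^bsup>-2L(0)\<^esup>\<close>, where \<open>dj/d\<tau> = c\<close>. Differentiating the two factors, and using
  \<open>exp(x L(1)) L(0) exp(-x L(1)) = L(0) + x L(1)\<close> (\<open>exp_op_L0\<close>), gives
  \<open>j\<^sup>2 dK/d\<tau> = (c\<^sup>2 j\<^sup>2 L(1) - 2 c j L(0)) K\<close> (\<open>weak_derivative_autK\<close>). On the other hand
  \<open>exp(x L(1)) L(-1) exp(-x L(1)) = L(-1) + 2 x L(0) + x\<^sup>2 L(1)\<close> (\<open>exp_op_Lm1\<close>) gives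
  \<open>j\<^sup>2 K L(-1) = (L(-1) - 2 c j L(0) + c\<^sup>2 j\<^sup>2 L(1)) K\<close> (\<open>autK_Lm1\<close>). Hence
  \<open>j\<^sup>2 dK/d\<tau> + L(-1) K = j\<^sup>2 K L(-1)\<close>: the failure of \<open>d\<close> to be equivariant cancels the failure of
  \<open>L(-1)\<close> to commute with \<open>K\<close>.

  This identity holds for every matrix of determinant one, and is applied twice (\<open>nabla_covariance\<close>).
  With an element of the group it shows that \<open>\<nabla> f\<close> is a section over the half plane. With \<open>\<sigma>\<close> taking
  \<open>\<infinity>\<close> to a cusp, where \<open>f(\<sigma>\<tau>) = K(\<sigma>,\<tau>) h(q)\<close>, it shows that the transport of \<open>\<nabla> f\<close> is
  \<open>(2\<pi>i/\<omega>) q h'(q) + L(-1) h(q)\<close>, which is again holomorphic at \<open>q = 0\<close>.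
\<close>

section \<open>Derivatives tested by linear functionals\<close>

text \<open>
  Testing by all linear functionals needs no topology on the vector space and reduces each rule of
  calculus to the scalar one. Finite dimension enters in the existence of a derivative.
\<close>

definition weak_derivative :: "(complex \<Rightarrow> 'v::ab_group_add \<Rightarrow> 'v) \<Rightarrow> (complex \<Rightarrow> 'v) \<Rightarrow> 'v \<Rightarrow>
    complex \<Rightarrow> bool" where
  "weak_derivative smul f v \<tau> \<longleftrightarrow> (\<forall>\<phi>. Vector_Spaces.linear smul (*) \<phi> \<longrightarrow>
     ((\<lambda>z. \<phi> (f z)) has_field_derivative \<phi> v) (at \<tau>))"

locale complex_vector_space = vector_space smul
  for smul :: "complex \<Rightarrow> 'v::ab_group_add \<Rightarrow> 'v"
begin

lemma linear_functionals_separate: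
  assumes "\<And>\<phi>. Vector_Spaces.linear smul (*) \<phi> \<Longrightarrow> \<phi> u = \<phi> v"
  shows "u = v"
proof -
  obtain B where B: "independent B" "span B = UNIV"
    using independent_extend_basis[OF independent_empty] span_extend_basis[OF independent_empty]
    by blast
  have eq: "representation B u b = representation B v b" for b
    using assms[OF linear_representation[OF B, of b]] .
  have "u = (\<Sum>b | representation B u b \<noteq> 0. smul (representation B u b) b)"
    using sum_nonzero_representation_eq[OF B(1), of u] B(2) by simp
  also have "\<dots> = (\<Sum>b | representation B v b \<noteq> 0. smul (representation B v b) b)"
    by (simp add: eq)
  also have "\<dots> = v"
    using sum_nonzero_representation_eq[OF B(1), of v] B(2) by simp
  finally show ?thesis .
qed

lemma weak_derivative_unique:
  assumes "weak_derivative smul f u \<tau>" "weak_derivative smul f v \<tau>"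
  shows "u = v"
proof (rule linear_functionals_separate)
  fix \<phi> assume "Vector_Spaces.linear smul (*) \<phi>"
  thus "\<phi> u = \<phi> v"
    using DERIV_unique assms unfolding weak_derivative_def by blast
qed

lemma vderiv_eq: "weak_derivative smul f v \<tau> \<Longrightarrow> vderiv smul f \<tau> = v"
  unfolding vderiv_def weak_derivative_def[symmetric]
  by (rule the_equality) (auto intro: weak_derivative_unique)

lemma weak_derivative_const: "weak_derivative smul (\<lambda>z. v) 0 \<tau>"
  unfolding weak_derivative_def
proof (intro allI impI)
  fix \<phi> assume "Vector_Spaces.linear smul (*) \<phi>"
  then interpret \<phi>: Vector_Spaces.linear smul "(*)" \<phi> .
  show "((\<lambda>z. \<phi> v) has_field_derivative \<phi> 0) (at \<tau>)"
    unfolding \<phi>.zero by (rule DERIV_const)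
qed

lemma weak_derivative_linear:
  assumes "Vector_Spaces.linear smul smul A" "weak_derivative smul f v \<tau>"
  shows "weak_derivative smul (\<lambda>z. A (f z)) (A v) \<tau>"
  unfolding weak_derivative_def
proof (intro allI impI)
  fix \<phi> assume "Vector_Spaces.linear smul (*) \<phi>"
  hence "Vector_Spaces.linear smul (*) (\<phi> \<circ> A)"
    using assms(1) Vector_Spaces.linear_compose by blast
  thus "((\<lambda>z. \<phi> (A (f z))) has_field_derivative \<phi> (A v)) (at \<tau>)"
    using assms(2) by (auto simp: weak_derivative_def)
qed

lemma weak_derivative_smul:
  assumes "(c has_field_derivative c') (at \<tau>)" "weak_derivative smul f v \<tau>"
  shows "weak_derivative smul (\<lambda>z. smul (c z) (f z)) (smul c' (f \<tau>) + smul (c \<tau>) v) \<tau>"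
  unfolding weak_derivative_def
proof (intro allI impI)
  fix \<phi> assume \<phi>: "Vector_Spaces.linear smul (*) \<phi>"
  interpret \<phi>: Vector_Spaces.linear smul "(*)" \<phi> by fact
  show "((\<lambda>z. \<phi> (smul (c z) (f z))) has_field_derivative \<phi> (smul c' (f \<tau>) + smul (c \<tau>) v)) (at \<tau>)"
    using assms(2) \<phi> unfolding \<phi>.scale \<phi>.add weak_derivative_def
    by (auto intro!: derivative_eq_intros assms(1))
qed

lemma weak_derivative_add:
  assumes "weak_derivative smul f u \<tau>" "weak_derivative smul g v \<tau>"
  shows "weak_derivative smul (\<lambda>z. f z + g z) (u + v) \<tau>"
  unfolding weak_derivative_def
proof (intro allI impI)
  fix \<phi> assume \<phi>: "Vector_Spaces.linear smul (*) \<phi>"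
  interpret \<phi>: Vector_Spaces.linear smul "(*)" \<phi> by fact
  show "((\<lambda>z. \<phi> (f z + g z)) has_field_derivative \<phi> (u + v)) (at \<tau>)"
    using assms \<phi> unfolding \<phi>.add weak_derivative_def by (auto intro!: derivative_eq_intros)
qed

lemma weak_derivative_sum:
  assumes "\<And>i. i \<in> I \<Longrightarrow> weak_derivative smul (f i) (v i) \<tau>"
  shows "weak_derivative smul (\<lambda>z. \<Sum>i\<in>I. f i z) (\<Sum>i\<in>I. v i) \<tau>"
  using assms by (induction I rule: infinite_finite_induct)
    (auto intro: weak_derivative_const weak_derivative_add)

lemma weak_derivative_chain:
  assumes "weak_derivative smul f v (g \<tau>)" "(g has_field_derivative d) (at \<tau>)"
  shows "weak_derivative smul (\<lambda>z. f (g z)) (smul d v) \<tau>"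
  unfolding weak_derivative_def
proof (intro allI impI)
  fix \<phi> assume \<phi>: "Vector_Spaces.linear smul (*) \<phi>"
  interpret \<phi>: Vector_Spaces.linear smul "(*)" \<phi> by fact
  show "((\<lambda>z. \<phi> (f (g z))) has_field_derivative \<phi> (smul d v)) (at \<tau>)"
    unfolding \<phi>.scale mult.commute[of d]
    using assms \<phi> unfolding weak_derivative_def by (intro DERIV_chain2) auto
qed

lemma weak_derivative_transform:
  assumes "weak_derivative smul f v \<tau>" "open S" "\<tau> \<in> S" "\<And>z. z \<in> S \<Longrightarrow> f z = g z"
  shows "weak_derivative smul g v \<tau>"
  unfolding weak_derivative_def
proof (intro allI impI)
  fix \<phi> assume "Vector_Spaces.linear smul (*) \<phi>"
  hence "((\<lambda>z. \<phi> (f z)) has_field_derivative \<phi> v) (at \<tau>)"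
    using assms(1) by (simp add: weak_derivative_def)
  thus "((\<lambda>z. \<phi> (g z)) has_field_derivative \<phi> v) (at \<tau>)"
    by (rule has_field_derivative_transform_within_open[OF _ assms(2,3)]) (simp add: assms(4))
qed

text \<open>
  Finite dimension makes the derivative exist: it is assembled from the derivatives of the finitely
  many coordinates. The coordinate functionals extend to the whole space through a larger basis.
\<close>

lemma holo_into_weak_derivative:
  assumes f: "holo_into smul (span B) S f" and "finite B" and S: "open S" "\<tau> \<in> S"
  shows "weak_derivative smul f (vderiv smul f \<tau>) \<tau>" and "vderiv smul f \<tau> \<in> span B"
proof -
  obtain C where C: "C \<subseteq> B" "independent C" "B \<subseteq> span C"
    using maximal_independent_subset by blast
  have "finite C" using C \<open>finite B\<close> finite_subset by blast
  have span_C: "span C = span B"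
    using span_mono[OF C(1)] span_minimal[OF C(3) subspace_span] by blast
  define R where "R b v = representation (extend_basis C) v b" for b v
  have lin: "Vector_Spaces.linear smul (*) (R b)" for b
    unfolding R_def using C
    by (intro linear_representation) (auto simp: independent_extend_basis)
  define v where "v = (\<Sum>b\<in>C. smul (deriv (\<lambda>z. R b (f z)) \<tau>) b)"
  have expand: "(\<Sum>b\<in>C. smul (R b (f z)) b) = f z" if "z \<in> S" for z
  proof -
    have "f z \<in> span C" using f that by (auto simp: holo_into_def span_C)
    moreover have "R b (f z) = representation C (f z) b" for b
      unfolding R_def
      using representation_extend[OF independent_extend_basis[OF C(2)] \<open>f z \<in> span C\<close>
          extend_basis_superset[OF C(2)]] by simp
    ultimately show ?thesis
      using sum_representation_eq[OF C(2) _ \<open>finite C\<close>] by simp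
  qed
  have hol: "(\<lambda>z. R b (f z)) holomorphic_on S" for b
    using f lin by (simp add: holo_into_def)
  have "weak_derivative smul (\<lambda>z. \<Sum>b\<in>C. smul (R b (f z)) b)
      (\<Sum>b\<in>C. smul (deriv (\<lambda>z. R b (f z)) \<tau>) b + smul (R b (f \<tau>)) 0) \<tau>"
    by (intro weak_derivative_sum weak_derivative_smul weak_derivative_const
        holomorphic_derivI[OF hol S])
  hence "weak_derivative smul f v \<tau>"
    using weak_derivative_transform[OF _ S expand] by (simp add: v_def)
  moreover from this have "vderiv smul f \<tau> = v" by (rule vderiv_eq)
  moreover have "v \<in> span B"
    unfolding v_def using C by (intro span_sum span_scale span_base) auto
  ultimately show "weak_derivative smul f (vderiv smul f \<tau>) \<tau>" "vderiv smul f \<tau> \<in> span B"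
    by auto
qed

lemma holo_into_vderiv:
  assumes f: "holo_into smul (span B) S f" and "finite B" and S: "open S"
  shows "holo_into smul (span B) S (vderiv smul f)"
  unfolding holo_into_def
proof (intro conjI allI impI)
  show "vderiv smul f \<in> S \<rightarrow> span B"
    using holo_into_weak_derivative[OF assms] by auto
  fix \<phi> assume \<phi>: "Vector_Spaces.linear smul (*) \<phi>"
  have "deriv (\<lambda>z. \<phi> (f z)) holomorphic_on S"
    using f S \<phi> by (intro holomorphic_deriv) (auto simp: holo_into_def)
  moreover have "deriv (\<lambda>z. \<phi> (f z)) z = \<phi> (vderiv smul f z)" if "z \<in> S" for z
    using holo_into_weak_derivative(1)[OF assms that] \<phi>
    by (intro DERIV_imp_deriv) (auto simp: weak_derivative_def)
  ultimately show "(\<lambda>z. \<phi> (vderiv smul f z)) holomorphic_on S"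
    by (rule holomorphic_transform)
qed

lemma holo_into_mono: "holo_into smul W S f \<Longrightarrow> W \<subseteq> W' \<Longrightarrow> holo_into smul W' S f"
  by (auto simp: holo_into_def)

lemma holo_into_linear:
  assumes "Vector_Spaces.linear smul smul A" "holo_into smul W S f" "A ` W \<subseteq> W'"
  shows "holo_into smul W' S (\<lambda>z. A (f z))"
  unfolding holo_into_def
proof (intro conjI allI impI)
  show "(\<lambda>z. A (f z)) \<in> S \<rightarrow> W'" using assms by (auto simp: holo_into_def)
  fix \<phi> assume "Vector_Spaces.linear smul (*) \<phi>"
  hence "Vector_Spaces.linear smul (*) (\<phi> \<circ> A)"
    using assms(1) Vector_Spaces.linear_compose by blast
  thus "(\<lambda>z. \<phi> (A (f z))) holomorphic_on S"
    using assms(2) by (auto simp: holo_into_def o_def)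
qed

lemma holo_into_smul:
  assumes "c holomorphic_on S" "holo_into smul W S f" "subspace W"
  shows "holo_into smul W S (\<lambda>z. smul (c z) (f z))"
  unfolding holo_into_def
proof (intro conjI allI impI)
  show "(\<lambda>z. smul (c z) (f z)) \<in> S \<rightarrow> W"
    using assms by (auto simp: holo_into_def Pi_iff subspace_scale)
  fix \<phi> assume \<phi>: "Vector_Spaces.linear smul (*) \<phi>"
  interpret \<phi>: Vector_Spaces.linear smul "(*)" \<phi> by fact
  show "(\<lambda>z. \<phi> (smul (c z) (f z))) holomorphic_on S"
    unfolding \<phi>.scale using assms \<phi> by (auto simp: holo_into_def intro: holomorphic_on_mult)
qed

lemma holo_into_add:
  assumes "holo_into smul W S f" "holo_into smul W S g" "subspace W"
  shows "holo_into smul W S (\<lambda>z. f z + g z)"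
  unfolding holo_into_def
proof (intro conjI allI impI)
  show "(\<lambda>z. f z + g z) \<in> S \<rightarrow> W"
    using assms by (auto simp: holo_into_def Pi_iff subspace_add)
  fix \<phi> assume \<phi>: "Vector_Spaces.linear smul (*) \<phi>"
  interpret \<phi>: Vector_Spaces.linear smul "(*)" \<phi> by fact
  show "(\<lambda>z. \<phi> (f z + g z)) holomorphic_on S"
    unfolding \<phi>.add using assms \<phi> by (auto simp: holo_into_def intro: holomorphic_on_add)
qed

lemma holo_into_cong:
  assumes "holo_into smul W S f" "\<And>z. z \<in> S \<Longrightarrow> f z = g z"
  shows "holo_into smul W S g"
  using assms unfolding holo_into_def by (auto simp: Pi_iff cong: holomorphic_cong)

section \<open>Exponentials of locally nilpotent operators\<close>

lemma linearI:
  assumes "\<And>u v. A (u + v) = A u + A v" "\<And>r v. A (smul r v) = smul r (A v)"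
  shows "Vector_Spaces.linear smul smul A"
  using assms by unfold_locales

lemma linear_smul:
  assumes "Vector_Spaces.linear smul smul A"
  shows "Vector_Spaces.linear smul smul (\<lambda>v. smul c (A v))"
  using Vector_Spaces.linear_compose[OF assms linear_scale_self[of c]] by (simp add: o_def)

lemma linear_funpow:
  "Vector_Spaces.linear smul smul A \<Longrightarrow> Vector_Spaces.linear smul smul (A ^^ k)"
  by (induction k) (auto simp: linear_id intro: Vector_Spaces.linear_compose)

lemma funpow_eq_0_mono:
  fixes A :: "'v \<Rightarrow> 'v"
  assumes "A 0 = 0" "(A ^^ n) v = 0" "n \<le> m"
  shows "(A ^^ m) v = 0"
proof -
  have "(A ^^ k) 0 = 0" for k using assms(1) by (induction k) auto
  moreover have "(A ^^ m) v = (A ^^ (m - n)) ((A ^^ n) v)"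
    using assms(3) by (simp flip: funpow_add comp_apply[of "A ^^ (m - n)"])
  ultimately show ?thesis using assms(2) by simp
qed

lemma exp_op_eq_sum:
  assumes "A 0 = 0" "(A ^^ n) v = 0"
  shows "exp_op smul x A v = (\<Sum>k<n. smul (x ^ k / fact k) ((A ^^ k) v))"
proof -
  have "k < n" if "(A ^^ k) v \<noteq> 0" for k
    using funpow_eq_0_mono[of A n v k] assms that by (meson not_less)
  thus ?thesis
    unfolding exp_op_def by (intro sum.mono_neutral_left) auto
qed

lemma linear_exp_op:
  assumes A: "Vector_Spaces.linear smul smul A" and nil: "\<And>v. \<exists>n. (A ^^ n) v = 0"
  shows "Vector_Spaces.linear smul smul (exp_op smul x A)"
proof -
  interpret A: Vector_Spaces.linear smul smul A by fact
  have pow: "(A ^^ k) (u + v) = (A ^^ k) u + (A ^^ k) v" "(A ^^ k) (smul r v) = smul r ((A ^^ k) v)"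
    for k u v r
    using module_hom.add module_hom.scale linear_funpow[OF A, of k, unfolded linear_iff_module_hom]
    by blast+
  show ?thesis
  proof (rule linearI)
    fix u v r
    obtain m n where mn: "(A ^^ m) u = 0" "(A ^^ n) v = 0" using nil by metis
    define l where "l = max m n"
    have l: "(A ^^ l) u = 0" "(A ^^ l) v = 0"
      using mn funpow_eq_0_mono[of A, OF A.zero] by (auto simp: l_def)
    show "exp_op smul x A (u + v) = exp_op smul x A u + exp_op smul x A v"
      using l by (simp add: exp_op_eq_sum[of _ l] A.zero pow scale_right_distrib sum.distrib)
    show "exp_op smul x A (smul r v) = smul r (exp_op smul x A v)"
      using l by (simp add: exp_op_eq_sum[of _ l] A.zero pow scale_sum_right mult_ac)
  qed
qed

text \<open>
  The left side is the series of \<open>exp(x A) v\<close> differentiated term by term in \<open>x\<close>. The default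
  \<open>0 - 1 = 0\<close> in the exponent is harmless, as the term for \<open>k = 0\<close> has the factor \<open>0\<close>.
\<close>

lemma exp_op_derivative_series:
  assumes A: "Vector_Spaces.linear smul smul A" and n: "(A ^^ n) v = 0"
  shows "(\<Sum>k<n. smul (of_nat k * x ^ (k - 1) / fact k) ((A ^^ k) v)) = A (exp_op smul x A v)"
proof -
  interpret A: Vector_Spaces.linear smul smul A by fact
  let ?g = "\<lambda>k. smul (of_nat k * x ^ (k - 1) / fact k) ((A ^^ k) v)"
  have "(\<Sum>k<n. ?g k) = (\<Sum>k<Suc n. ?g k)" using n by simp
  also have "\<dots> = (\<Sum>k<n. ?g (Suc k))" by (subst sum.lessThan_Suc_shift) simp
  also have "\<dots> = (\<Sum>k<n. smul (x ^ k / fact k) (A ((A ^^ k) v)))"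
    by (intro sum.cong refl arg_cong2[where f=smul]) (auto simp: fact_Suc divide_simps simp del: of_nat_Suc)
  also have "\<dots> = A (exp_op smul x A v)"
    using n by (simp add: exp_op_eq_sum[of _ n] A.zero A.sum A.scale)
  finally show ?thesis .
qed

text \<open>
  One exponent of nilpotency for all nearby values turns the series into a finite sum whose length does
  not vary with the point, so that the product rule applies termwise.
\<close>

lemma weak_derivative_exp_op:
  assumes A: "Vector_Spaces.linear smul smul A"
    and x: "(x has_field_derivative x') (at \<tau>)" and g: "weak_derivative smul g g' \<tau>"
    and S: "open S" "\<tau> \<in> S" and nil: "\<And>z. z \<in> S \<Longrightarrow> (A ^^ n) (g z) = 0" "(A ^^ n) g' = 0"
  shows "weak_derivative smul (\<lambda>z. exp_op smul (x z) A (g z))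
    (smul x' (A (exp_op smul (x \<tau>) A (g \<tau>))) + exp_op smul (x \<tau>) A g') \<tau>"
proof -
  interpret A: Vector_Spaces.linear smul smul A by fact
  let ?d = "\<lambda>k. smul (of_nat k * x \<tau> ^ (k - 1) * x' / fact k) ((A ^^ k) (g \<tau>))
      + smul (x \<tau> ^ k / fact k) ((A ^^ k) g')"
  have "((\<lambda>z. x z ^ k / fact k) has_field_derivative of_nat k * x \<tau> ^ (k - 1) * x' / fact k) (at \<tau>)"
    for k
    using x by (auto intro!: derivative_eq_intros)
  hence "weak_derivative smul (\<lambda>z. \<Sum>k<n. smul (x z ^ k / fact k) ((A ^^ k) (g z))) (\<Sum>k<n. ?d k) \<tau>"
    by (intro weak_derivative_sum weak_derivative_smul weak_derivative_linear[OF linear_funpow[OF A] g])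
  moreover have "(\<Sum>k<n. smul (of_nat k * x \<tau> ^ (k - 1) * x' / fact k) ((A ^^ k) (g \<tau>)))
      = smul x' (A (exp_op smul (x \<tau>) A (g \<tau>)))"
    unfolding exp_op_derivative_series[OF A nil(1)[OF S(2)], symmetric] scale_sum_right scale_scale
    by (intro sum.cong refl arg_cong2[where f=smul]) auto
  hence "(\<Sum>k<n. ?d k) = smul x' (A (exp_op smul (x \<tau>) A (g \<tau>))) + exp_op smul (x \<tau>) A g'"
    using nil(2) by (simp add: sum.distrib exp_op_eq_sum[of A n g'] A.zero)
  ultimately have "weak_derivative smul (\<lambda>z. \<Sum>k<n. smul (x z ^ k / fact k) ((A ^^ k) (g z)))
      (smul x' (A (exp_op smul (x \<tau>) A (g \<tau>))) + exp_op smul (x \<tau>) A g') \<tau>"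
    by (simp only:)
  thus ?thesis
    by (rule weak_derivative_transform[OF _ S]) (rule exp_op_eq_sum[OF A.zero nil(1), symmetric])
qed

end

section \<open>Homogeneous components and the filtration\<close>

sublocale vertex_algebra \<subseteq> complex_vector_space ..

context graded_vertex_algebra begin

lemma decomposes_component: "decomposes V (\<lambda>n. component V n v) v"
  unfolding component_def using theI'[OF direct_sum] .

lemma component_unique: "decomposes V c v \<Longrightarrow> component V n v = c n"
  using decomposes_component direct_sum by metis

lemma component_in_grade: "component V n v \<in> V n"
  and finite_support: "finite {n. component V n v \<noteq> 0}"
  and sum_components: "(\<Sum>n | component V n v \<noteq> 0. component V n v) = v"
  using decomposes_component[of v] by (auto simp: decomposes_def)

lemma decomposesI:
  assumes "\<And>n. c n \<in> V n" "finite A" "\<And>n. n \<notin> A \<Longrightarrow> c n = 0" "v = (\<Sum>n\<in>A. c n)"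
  shows "decomposes V c v"
proof -
  have sub: "{n. c n \<noteq> 0} \<subseteq> A" using assms(3) by blast
  moreover have "(\<Sum>n\<in>A. c n) = (\<Sum>n | c n \<noteq> 0. c n)"
    using assms(2) sub by (intro sum.mono_neutral_right) auto
  ultimately show ?thesis
    using assms finite_subset by (auto simp: decomposes_def)
qed

lemma sum_components_superset:
  assumes "finite A" "{n. component V n v \<noteq> 0} \<subseteq> A"
  shows "(\<Sum>n\<in>A. component V n v) = v"
proof -
  have "(\<Sum>n\<in>A. component V n v) = (\<Sum>n | component V n v \<noteq> 0. component V n v)"
    using assms by (intro sum.mono_neutral_right) auto
  thus ?thesis by (simp add: sum_components)
qed

lemma component_homogeneous:
  assumes "u \<in> V m" shows "component V n u = (if n = m then u else 0)"
  by (rule component_unique, rule decomposesI[of _ "{m}"])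
    (use assms in \<open>auto intro: subspace_0 subspace_grade\<close>)

lemma linear_component: "Vector_Spaces.linear smul smul (component V n)"
proof (rule linearI)
  fix u v r
  let ?S = "\<lambda>v. {n. component V n v \<noteq> 0}"
  show "component V n (u + v) = component V n u + component V n v"
  proof (rule component_unique, rule decomposesI[of _ "?S u \<union> ?S v"])
    show "u + v = (\<Sum>n\<in>?S u \<union> ?S v. component V n u + component V n v)"
      by (simp add: sum.distrib sum_components_superset finite_support)
  qed (auto simp: finite_support subspace_add subspace_grade component_in_grade)
  show "component V n (smul r v) = smul r (component V n v)"
  proof (rule component_unique, rule decomposesI[of _ "?S v"])
    show "smul r v = (\<Sum>n\<in>?S v. smul r (component V n v))"
      by (simp flip: scale_sum_right add: sum_components)
  qed (auto simp: finite_support subspace_scale subspace_grade component_in_grade)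
qed

lemma linear_eq_on_grades:
  assumes "Vector_Spaces.linear smul smul F" "Vector_Spaces.linear smul smul G"
    and "\<And>n u. u \<in> V n \<Longrightarrow> F u = G u"
  shows "F v = G v"
proof -
  interpret F: Vector_Spaces.linear smul smul F by fact
  interpret G: Vector_Spaces.linear smul smul G by fact
  have "F (\<Sum>n | component V n v \<noteq> 0. component V n v)
      = G (\<Sum>n | component V n v \<noteq> 0. component V n v)"
    unfolding F.sum G.sum by (intro sum.cong refl assms(3)[OF component_in_grade])
  thus ?thesis by (simp add: sum_components)
qed

lemma filtr_graded_map:
  assumes A: "Vector_Spaces.linear smul smul A"
    and grade: "\<And>n u. u \<in> V n \<Longrightarrow> A u \<in> V (n + d)" and v: "v \<in> filtr smul V N"
  shows "A v \<in> filtr smul V (N + d)"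
  using v unfolding filtr_def
proof (induction rule: span_induct)
  case base
  interpret A: Vector_Spaces.linear smul smul A by fact
  show ?case by (auto simp: subspace_def A.add A.scale A.zero span_add span_scale span_zero)
next
  case (step u)
  then obtain n where "n \<le> N" "u \<in> V n" by auto
  thus ?case using grade by (intro span_base) force
qed

lemma filtr_mono: "M \<le> N \<Longrightarrow> filtr smul V M \<subseteq> filtr smul V N"
  unfolding filtr_def by (intro span_mono UN_mono) auto

lemma subspace_filtr: "subspace (filtr smul V N)"
  by (simp add: filtr_def)

lemma component_filtr:
  assumes "v \<in> filtr smul V N" "n > N"
  shows "component V n v = 0"
  using assms(1) unfolding filtr_def
proof (induction rule: span_induct)
  case base
  interpret P: Vector_Spaces.linear smul smul "component V n" by (rule linear_component)
  show ?case by (auto simp: subspace_def P.add P.scale P.zero)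
next
  case (step u)
  thus ?case using assms(2) by (auto simp: component_homogeneous)
qed

lemma in_filtr: "\<exists>N. v \<in> filtr smul V N"
proof
  let ?S = "{n. component V n v \<noteq> 0}"
  have "n \<le> Max ?S" if "n \<in> ?S" for n using that finite_support by (rule Max_ge[rotated])
  hence "(\<Sum>n\<in>?S. component V n v) \<in> filtr smul V (Max ?S)"
    unfolding filtr_def using component_in_grade by (intro span_sum span_base) blast
  thus "v \<in> filtr smul V (Max ?S)" by (simp add: sum_components)
qed

lemma pow_L0_eq_sum:
  assumes "finite A" "{n. component V n v \<noteq> 0} \<subseteq> A"
  shows "pow_L0 smul V y k v = (\<Sum>n\<in>A. smul (y powi (k * n)) (component V n v))"
  unfolding pow_L0_def using assms by (intro sum.mono_neutral_left) auto

lemma pow_L0_homogeneous: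
  assumes "u \<in> V n" shows "pow_L0 smul V y k u = smul (y powi (k * n)) u"
  using assms by (subst pow_L0_eq_sum[of "{n}"]) (auto simp: component_homogeneous)

lemma linear_pow_L0: "Vector_Spaces.linear smul smul (pow_L0 smul V y k)"
proof (rule linearI)
  fix u v r
  interpret P: Vector_Spaces.linear smul smul "component V n" for n by (rule linear_component)
  let ?S = "\<lambda>v. {n. component V n v \<noteq> 0}"
  have fin: "finite (?S u \<union> ?S v)" by (simp add: finite_support)
  have sub: "?S (u + v) \<subseteq> ?S u \<union> ?S v" "?S u \<subseteq> ?S u \<union> ?S v" "?S v \<subseteq> ?S u \<union> ?S v"
    "?S (smul r v) \<subseteq> ?S v"
    by (auto simp: P.add P.scale)
  show "pow_L0 smul V y k (u + v) = pow_L0 smul V y k u + pow_L0 smul V y k v"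
    unfolding sub(1-3)[THEN pow_L0_eq_sum[OF fin]] P.add scale_right_distrib sum.distrib ..
  show "pow_L0 smul V y k (smul r v) = smul r (pow_L0 smul V y k v)"
    unfolding sub(4)[THEN pow_L0_eq_sum[OF finite_support]]
    unfolding pow_L0_def P.scale scale_sum_right by (simp add: mult.commute)
qed

end

context qvoa begin

lemma L_commutators:
  "L 1 (L 0 v) = L 0 (L 1 v) + L 1 v"
  "L 1 (L (-1) v) = L (-1) (L 1 v) + smul 2 (L 0 v)"
  using sl2[of 1 0 v] sl2[of 1 "-1" v] by (simp_all add: algebra_simps)

lemmas linear_Lm1 = linear_L[of "-1", simplified]
  and linear_L0 = linear_L[of 0, simplified]
  and linear_L1 = linear_L[of 1, simplified]

sublocale Lm1: Vector_Spaces.linear smul smul "L (-1)" by (rule linear_Lm1)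
sublocale L0: Vector_Spaces.linear smul smul "L 0" by (rule linear_L0)
sublocale L1: Vector_Spaces.linear smul smul "L 1" by (rule linear_L1)

lemma Lm1_grade: "u \<in> V n \<Longrightarrow> L (-1) u \<in> V (n + 1)"
  using mode_grade[of u n vac 0 "-2"] vac_grade by (simp add: Lm1_derivation add.commute)

text \<open>
  \<open>L(0)\<close> is diagonal with distinct eigenvalues on the homogeneous spaces, so the grading can be read off
  from it.
\<close>

lemma component_L0: "component V n (L 0 v) = smul (of_int n) (component V n v)"
proof (rule linear_eq_on_grades[where F = "\<lambda>v. component V n (L 0 v)"])
  show "Vector_Spaces.linear smul smul (\<lambda>v. component V n (L 0 v))"
    using Vector_Spaces.linear_compose[OF linear_L0 linear_component] by (simp add: o_def)
  show "Vector_Spaces.linear smul smul (\<lambda>v. smul (of_int n) (component V n v))"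
    by (rule linear_smul[OF linear_component])
  fix m u assume "u \<in> V m"
  moreover from this have "L 0 u \<in> V m" by (simp add: L0_grade subspace_scale subspace_grade)
  ultimately show "component V n (L 0 u) = smul (of_int n) (component V n u)"
    by (simp add: component_homogeneous L0_grade)
qed

text \<open>
  The axioms do not state how \<open>L(1)\<close> acts on degrees; it follows from \<open>[L(1), L(0)] = L(1)\<close>, which
  makes \<open>L(1) u\<close> an eigenvector of \<open>L(0)\<close> with eigenvalue \<open>n - 1\<close>.
\<close>

lemma L1_grade:
  assumes "u \<in> V n" shows "L 1 u \<in> V (n - 1)"
proof -
  have eig: "L 0 (L 1 u) = smul (of_int (n - 1)) (L 1 u)"
    using L_commutators(1)[of u] assms by (simp add: L0_grade L1.scale algebra_simps)
  have "component V m (L 1 u) = 0" if "m \<noteq> n - 1" for m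
  proof -
    interpret P: Vector_Spaces.linear smul smul "component V m" by (rule linear_component)
    have "smul (of_int m) (component V m (L 1 u)) = smul (of_int (n - 1)) (component V m (L 1 u))"
      unfolding component_L0[symmetric] eig P.scale ..
    thus ?thesis using that by (simp only: scale_cancel_right of_int_eq_iff) auto
  qed
  hence "L 1 u = component V (n - 1) (L 1 u)"
    using sum_components_superset[of "{n - 1}" "L 1 u"] by fastforce
  thus ?thesis using component_in_grade by metis
qed

lemma filtr_trivial:
  "\<exists>n0. \<forall>N<n0. filtr smul V N = {0}"
proof -
  obtain n0 where "\<And>n. n < n0 \<Longrightarrow> V n = {0}" using bounded_below by blast
  hence "filtr smul V N \<subseteq> span {0}" if "N < n0" for N
    unfolding filtr_def using that by (intro span_mono) auto
  thus ?thesis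
    using subspace_0[OF subspace_filtr] by (intro exI[of _ n0]) auto
qed

lemma filtr_finite_dim: "\<exists>B. finite B \<and> filtr smul V N = span B"
proof -
  obtain n0 where n0: "\<And>n. n < n0 \<Longrightarrow> V n = {0}" using bounded_below by blast
  obtain B where B: "\<And>n. finite (B n)" "\<And>n. V n = span (B n)" using finite_dim_grade by metis
  let ?C = "\<Union>n\<in>{n0..N}. B n"
  have "V n \<subseteq> span ?C" if "n \<le> N" for n
  proof (cases "n < n0")
    case True thus ?thesis using n0 by (simp add: span_zero)
  next
    case False thus ?thesis unfolding B(2) using that by (intro span_mono UN_upper) auto
  qed
  hence "filtr smul V N \<subseteq> span ?C" unfolding filtr_def by (intro span_minimal) auto
  moreover have "span ?C \<subseteq> filtr smul V N"
    unfolding filtr_def by (intro span_mono UN_mono) (auto simp: B(2) span_base)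
  ultimately show ?thesis using B(1) by (intro exI[of _ ?C]) auto
qed

lemma L1_funpow_filtr: "v \<in> filtr smul V N \<Longrightarrow> (L 1 ^^ k) v \<in> filtr smul V (N - int k)"
proof (induction k)
  case (Suc k)
  thus ?case
    using filtr_graded_map[OF linear_L1, of "-1" _ "N - int k"] L1_grade
    by (simp add: algebra_simps)
qed simp

text \<open>
  Each application of \<open>L(1)\<close> lowers the filtration by one, and the grading is bounded below.
\<close>

lemma L1_uniformly_nilpotent: "\<exists>n. \<forall>v\<in>filtr smul V N. (L 1 ^^ n) v = 0"
proof -
  obtain n0 where n0: "\<And>N. N < n0 \<Longrightarrow> filtr smul V N = {0}" using filtr_trivial by blast
  \<comment> \<open>The number of steps from degree \<open>N\<close> to below the lowest degree \<open>n0\<close>.\<close>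
  have "N - int (nat (N - n0 + 1)) < n0" by linarith
  from n0[OF this] show ?thesis using L1_funpow_filtr[of _ N "nat (N - n0 + 1)"] by auto
qed

lemma L1_locally_nilpotent: "\<exists>n. (L 1 ^^ n) v = 0"
  using L1_uniformly_nilpotent in_filtr by metis

lemma filtr_support: "\<exists>A. finite A \<and> (\<forall>v\<in>filtr smul V N. {n. component V n v \<noteq> 0} \<subseteq> A)"
proof -
  obtain n0 where n0: "\<And>n. n < n0 \<Longrightarrow> V n = {0}" using bounded_below by blast
  have "{n. component V n v \<noteq> 0} \<subseteq> {n0..N}" if "v \<in> filtr smul V N" for v
    using that n0 component_in_grade[of _ v] component_filtr[of v N] by force
  thus ?thesis by (intro exI[of _ "{n0..N}"]) auto
qed

lemma pow_L0_filtr: "v \<in> filtr smul V N \<Longrightarrow> pow_L0 smul V y k v \<in> filtr smul V N"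
  using filtr_graded_map[OF linear_pow_L0, where d = 0]
  by (simp add: pow_L0_homogeneous subspace_scale subspace_grade)

text \<open>
  Since \<open>L(-1)\<close> raises degrees by one, moving \<open>y\<^bsup>k L(0)\<^esup>\<close> past it costs the factor \<open>y\<^sup>k\<close>. For \<open>k = -2\<close>
  this factor cancels the factor \<open>j\<^sup>2\<close> of the cotangent bundle.
\<close>

lemma pow_L0_Lm1:
  assumes "y \<noteq> 0"
  shows "pow_L0 smul V y k (L (-1) v) = smul (y powi k) (L (-1) (pow_L0 smul V y k v))"
proof (rule linear_eq_on_grades[where F = "\<lambda>v. pow_L0 smul V y k (L (-1) v)"])
  show "Vector_Spaces.linear smul smul (\<lambda>v. pow_L0 smul V y k (L (-1) v))"
    using Vector_Spaces.linear_compose[OF linear_Lm1 linear_pow_L0] by (simp add: o_def)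
  have "Vector_Spaces.linear smul smul (\<lambda>v. L (-1) (pow_L0 smul V y k v))"
    using Vector_Spaces.linear_compose[OF linear_pow_L0 linear_Lm1] by (simp add: o_def)
  thus "Vector_Spaces.linear smul smul (\<lambda>v. smul (y powi k) (L (-1) (pow_L0 smul V y k v)))"
    by (rule linear_smul)
  fix n u assume u: "u \<in> V n"
  have "k * (n + 1) = k + k * n" by algebra
  hence "y powi (k * (n + 1)) = y powi k * y powi (k * n)"
    using assms by (simp add: power_int_add)
  thus "pow_L0 smul V y k (L (-1) u) = smul (y powi k) (L (-1) (pow_L0 smul V y k u))"
    using u Lm1_grade[OF u] by (simp add: pow_L0_homogeneous Lm1.scale)
qed

section \<open>Conjugation by the exponential of L(1)\<close>

lemma L1_funpow_L0: "(L 1 ^^ k) (L 0 v) = L 0 ((L 1 ^^ k) v) + smul (of_nat k) ((L 1 ^^ k) v)"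
  by (induction k) (simp_all add: L1.add L1.scale L_commutators scale_left_distrib algebra_simps)

text \<open>
  Commuting \<open>L(1)\<close> past \<open>L(-1)\<close> leaves a term \<open>2 L(0)\<close>, for each of the \<open>k + 1\<close> factors; commuting these
  \<open>L(0)\<close> to the left past the remaining powers of \<open>L(1)\<close> produces the last term.
\<close>

lemma L1_funpow_Lm1:
  "(L 1 ^^ Suc k) (L (-1) v) = L (-1) ((L 1 ^^ Suc k) v)
     + smul (2 * of_nat (Suc k)) (L 0 ((L 1 ^^ k) v)) + smul (of_nat (Suc k * k)) ((L 1 ^^ k) v)"
proof (induction k)
  case 0
  show ?case by (simp add: L_commutators)
next
  case (Suc k)
  define w where "w = (L 1 ^^ k) v"
  have "(L 1 ^^ Suc (Suc k)) (L (-1) v) = L (-1) (L 1 (L 1 w)) + smul 2 (L 0 (L 1 w))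
      + smul (2 * of_nat (Suc k)) (L 0 (L 1 w) + L 1 w) + smul (of_nat (Suc k * k)) (L 1 w)"
    using Suc by (simp add: w_def L1.add L1.scale L_commutators del: of_nat_Suc of_nat_mult)
  also have "\<dots> = L (-1) (L 1 (L 1 w)) + smul (2 * of_nat (Suc (Suc k))) (L 0 (L 1 w))
      + smul (of_nat (Suc (Suc k) * Suc k)) (L 1 w)"
    by (simp add: algebra_simps flip: scale_left_distrib)
  finally show ?case by (simp add: w_def)
qed

text \<open>
  The terms \<open>k L(1)\<^sup>k\<close> left over by the commutation assemble into the derivative series of the
  exponential.
\<close>

lemma exp_op_L0:
  "exp_op smul x (L 1) (L 0 v) = L 0 (exp_op smul x (L 1) v) + smul x (L 1 (exp_op smul x (L 1) v))"
proof -
  obtain n where n: "(L 1 ^^ n) v = 0" using L1_locally_nilpotent by metis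
  have "exp_op smul x (L 1) (L 0 v) = (\<Sum>k<n. smul (x ^ k / fact k) ((L 1 ^^ k) (L 0 v)))"
    by (rule exp_op_eq_sum) (simp_all add: L1.zero L1_funpow_L0 n L0.zero)
  also have "\<dots> = (\<Sum>k<n. L 0 (smul (x ^ k / fact k) ((L 1 ^^ k) v))
      + smul x (smul (of_nat k * x ^ (k - 1) / fact k) ((L 1 ^^ k) v)))"
  proof (rule sum.cong[OF refl])
    fix k
    have "x ^ k / fact k * of_nat k = x * (of_nat k * x ^ (k - 1) / fact k)"
      by (cases k) (auto simp del: of_nat_Suc)
    thus "smul (x ^ k / fact k) ((L 1 ^^ k) (L 0 v)) = L 0 (smul (x ^ k / fact k) ((L 1 ^^ k) v))
      + smul x (smul (of_nat k * x ^ (k - 1) / fact k) ((L 1 ^^ k) v))"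
      by (simp only: L1_funpow_L0 L0.scale scale_right_distrib scale_scale)
  qed
  also have "\<dots> = L 0 (exp_op smul x (L 1) v) + smul x (L 1 (exp_op smul x (L 1) v))"
    unfolding sum.distrib L0.sum[symmetric] scale_sum_right[symmetric]
      exp_op_derivative_series[OF linear_L1 n] exp_op_eq_sum[OF L1.zero n, symmetric] ..
  finally show ?thesis .
qed

text \<open>
  The conjugate of \<open>L(-1)\<close> is a polynomial of degree two in \<open>x\<close>, because \<open>L(1)\<close> takes \<open>L(-1)\<close> to
  \<open>2 L(0)\<close>, then to \<open>2 L(1)\<close>, then to \<open>0\<close> under repeated commutators. In the sum the index is shifted by
  one, so that the two lower-order terms become series for \<open>exp(x L(1)) v\<close> and its derivative.
\<close>

lemma exp_op_Lm1:
  "exp_op smul x (L 1) (L (-1) v) = L (-1) (exp_op smul x (L 1) v)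
     + smul (2 * x) (L 0 (exp_op smul x (L 1) v)) + smul (x\<^sup>2) (L 1 (exp_op smul x (L 1) v))"
proof -
  obtain n where n: "(L 1 ^^ n) v = 0" using L1_locally_nilpotent by metis
  hence n': "(L 1 ^^ Suc n) v = 0" by (simp add: L1.zero)
  have zero: "(L 1 ^^ Suc n) (L (-1) v) = 0"
    unfolding L1_funpow_Lm1 n n' by (simp add: L0.zero Lm1.zero)
  let ?c = "\<lambda>k. x ^ k / fact k :: complex"
  have "exp_op smul x (L 1) (L (-1) v) = (\<Sum>k<Suc n. smul (?c k) ((L 1 ^^ k) (L (-1) v)))"
    by (rule exp_op_eq_sum[OF L1.zero zero])
  also have "\<dots> = smul (?c 0) ((L 1 ^^ 0) (L (-1) v))
      + (\<Sum>k<n. smul (?c (Suc k)) ((L 1 ^^ Suc k) (L (-1) v)))"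
    by (rule sum.lessThan_Suc_shift)
  also have "(\<Sum>k<n. smul (?c (Suc k)) ((L 1 ^^ Suc k) (L (-1) v))) =
      (\<Sum>k<n. L (-1) (smul (?c (Suc k)) ((L 1 ^^ Suc k) v)) + smul (2 * x) (L 0 (smul (?c k) ((L 1 ^^ k) v)))
        + smul (x\<^sup>2) (smul (of_nat k * x ^ (k - 1) / fact k) ((L 1 ^^ k) v)))"
  proof (rule sum.cong[OF refl])
    fix k
    have step: "?c (Suc k) * of_nat (Suc k) = x * ?c k"
      by (simp add: divide_simps del: of_nat_Suc)
    have c1: "?c (Suc k) * (2 * of_nat (Suc k)) = 2 * x * ?c k"
      unfolding mult.left_commute[of _ 2] step by (rule mult.assoc[symmetric])
    have "?c (Suc k) * of_nat (Suc k * k) = x * (?c k * of_nat k)"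
      unfolding of_nat_mult mult.assoc[symmetric] step ..
    also have "?c k * of_nat k = x * (of_nat k * x ^ (k - 1) / fact k)"
      by (cases k) (simp_all del: of_nat_Suc)
    finally have c2: "?c (Suc k) * of_nat (Suc k * k) = x\<^sup>2 * (of_nat k * x ^ (k - 1) / fact k)"
      by (simp only: power2_eq_square mult.assoc)
    show "smul (?c (Suc k)) ((L 1 ^^ Suc k) (L (-1) v)) = L (-1) (smul (?c (Suc k)) ((L 1 ^^ Suc k) v))
        + smul (2 * x) (L 0 (smul (?c k) ((L 1 ^^ k) v)))
        + smul (x\<^sup>2) (smul (of_nat k * x ^ (k - 1) / fact k) ((L 1 ^^ k) v))"
      by (simp only: L1_funpow_Lm1 c1 c2 L0.scale Lm1.scale scale_right_distrib scale_scale)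
  qed
  also have "\<dots> = L (-1) (\<Sum>k<n. smul (?c (Suc k)) ((L 1 ^^ Suc k) v))
      + smul (2 * x) (L 0 (exp_op smul x (L 1) v)) + smul (x\<^sup>2) (L 1 (exp_op smul x (L 1) v))"
    unfolding sum.distrib L0.sum[symmetric] Lm1.sum[symmetric] scale_sum_right[symmetric]
      exp_op_derivative_series[OF linear_L1 n] exp_op_eq_sum[OF L1.zero n, symmetric] ..
  also have "smul (?c 0) ((L 1 ^^ 0) (L (-1) v)) + \<dots> =
      L (-1) (smul (?c 0) ((L 1 ^^ 0) v) + (\<Sum>k<n. smul (?c (Suc k)) ((L 1 ^^ Suc k) v)))
      + smul (2 * x) (L 0 (exp_op smul x (L 1) v)) + smul (x\<^sup>2) (L 1 (exp_op smul x (L 1) v))"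
    by (simp add: Lm1.add add.assoc)
  also have "smul (?c 0) ((L 1 ^^ 0) v) + (\<Sum>k<n. smul (?c (Suc k)) ((L 1 ^^ Suc k) v))
      = exp_op smul x (L 1) v"
    unfolding exp_op_eq_sum[OF L1.zero n'] by (rule sum.lessThan_Suc_shift[symmetric])
  finally show ?thesis .
qed

section \<open>The derivative of the automorphy factor\<close>

lemma L0_component: "L 0 (component V n v) = smul (of_int n) (component V n v)"
  by (rule L0_grade[OF component_in_grade])

text \<open>
  A bound on the filtration leaves finitely many degrees, common to all nearby points. In each of them
  the logarithmic derivative of \<open>y\<^bsup>kn\<^esup>\<close> is \<open>k n y'/y\<close>, and the factor \<open>n\<close> is the action of \<open>L(0)\<close>.
\<close>

lemma weak_derivative_pow_L0:
  assumes y: "(y has_field_derivative y') (at \<tau>)" "y \<tau> \<noteq> 0"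
    and f: "weak_derivative smul f f' \<tau>" and S: "open S" "\<tau> \<in> S"
    and filtr: "\<And>z. z \<in> S \<Longrightarrow> f z \<in> filtr smul V N" "f' \<in> filtr smul V N"
  shows "weak_derivative smul (\<lambda>z. pow_L0 smul V (y z) k (f z))
    (smul (of_int k * y' / y \<tau>) (L 0 (pow_L0 smul V (y \<tau>) k (f \<tau>))) + pow_L0 smul V (y \<tau>) k f') \<tau>"
proof -
  obtain A where A: "finite A" "\<And>v. v \<in> filtr smul V N \<Longrightarrow> {n. component V n v \<noteq> 0} \<subseteq> A"
    using filtr_support[of N] by metis
  \<comment> \<open>Summing over the fixed set \<open>A\<close>, as the support of \<open>f z\<close> may vary with \<open>z\<close>.\<close>
  note eq_sum = pow_L0_eq_sum[OF A(1) A(2)]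
  let ?d = "\<lambda>n. of_int (k * n) * y \<tau> powi (k * n - 1) * y'"
  have "((\<lambda>z. y z powi (k * n)) has_field_derivative ?d n) (at \<tau>)" for n
    using y by (intro DERIV_power_int) auto
  hence deriv: "weak_derivative smul (\<lambda>z. \<Sum>n\<in>A. smul (y z powi (k * n)) (component V n (f z)))
      (\<Sum>n\<in>A. smul (?d n) (component V n (f \<tau>)) + smul (y \<tau> powi (k * n)) (component V n f')) \<tau>"
    by (intro weak_derivative_sum weak_derivative_smul weak_derivative_linear[OF linear_component f])
  have "?d n = of_int k * y' / y \<tau> * (y \<tau> powi (k * n) * of_int n)" for n
    using y(2) by (simp add: power_int_diff)
  hence "(\<Sum>n\<in>A. smul (?d n) (component V n (f \<tau>)))
      = smul (of_int k * y' / y \<tau>) (L 0 (pow_L0 smul V (y \<tau>) k (f \<tau>)))"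
    unfolding eq_sum[OF filtr(1)[OF S(2)]] L0.sum L0.scale L0_component scale_sum_right scale_scale
    by simp
  with deriv have "weak_derivative smul (\<lambda>z. \<Sum>n\<in>A. smul (y z powi (k * n)) (component V n (f z)))
      (smul (of_int k * y' / y \<tau>) (L 0 (pow_L0 smul V (y \<tau>) k (f \<tau>))) + pow_L0 smul V (y \<tau>) k f') \<tau>"
    by (simp only: sum.distrib eq_sum[OF filtr(2)])
  thus ?thesis
    by (rule weak_derivative_transform[OF _ S]) (rule eq_sum[OF filtr(1), symmetric])
qed

lemma linear_exp_L1: "Vector_Spaces.linear smul smul (exp_op smul x (L 1))"
  by (rule linear_exp_op[OF linear_L1 L1_locally_nilpotent])

lemma linear_autK: "Vector_Spaces.linear smul smul (autK smul V L \<gamma> \<tau>)"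
  using Vector_Spaces.linear_compose[OF linear_pow_L0 linear_exp_L1]
  by (simp add: autK_def[abs_def] o_def)

lemma autj_has_derivative: "(autj \<gamma> has_field_derivative of_real (\<gamma>$2$1)) (at \<tau>)"
  unfolding autj_def[abs_def] by (auto intro!: derivative_eq_intros)

text \<open>
  The outer factor contributes \<open>-c\<^sup>2 L(1)\<close> and the inner one \<open>-(2c/j) L(0)\<close>. Moving the latter
  out of the exponential adds \<open>-(2c/j)(-c j) L(1) = 2 c\<^sup>2 L(1)\<close>, so that \<open>c\<^sup>2 L(1)\<close> remains.
\<close>

lemma weak_derivative_autK:
  fixes \<gamma> :: "real^2^2"
  defines "c \<equiv> complex_of_real (\<gamma>$2$1)"
  assumes j: "autj \<gamma> \<tau> \<noteq> 0"
    and f: "weak_derivative smul f f' \<tau>" and S: "open S" "\<tau> \<in> S"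
    and filtr: "\<And>z. z \<in> S \<Longrightarrow> f z \<in> filtr smul V N" "f' \<in> filtr smul V N"
  shows "weak_derivative smul (\<lambda>z. autK smul V L \<gamma> z (f z))
    (smul (c\<^sup>2) (L 1 (autK smul V L \<gamma> \<tau> (f \<tau>)))
      - smul (2 * c / autj \<gamma> \<tau>) (L 0 (autK smul V L \<gamma> \<tau> (f \<tau>))) + autK smul V L \<gamma> \<tau> f') \<tau>"
proof -
  let ?j = "autj \<gamma> \<tau>" and ?x = "\<lambda>z. - c * autj \<gamma> z"
  define g where "g z = pow_L0 smul V (autj \<gamma> z) (-2) (f z)" for z
  define g' where "g' = smul (of_int (-2) * c / ?j) (L 0 (g \<tau>)) + pow_L0 smul V ?j (-2) f'"
  define u where "u = exp_op smul (?x \<tau>) (L 1) (g \<tau>)"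
  interpret E: Vector_Spaces.linear smul smul "exp_op smul (?x \<tau>) (L 1)" by (rule linear_exp_L1)
  have u: "u = autK smul V L \<gamma> \<tau> (f \<tau>)" by (simp add: u_def g_def autK_def c_def)
  have g: "weak_derivative smul g g' \<tau>"
    using weak_derivative_pow_L0[OF autj_has_derivative j f S filtr, of "-2"]
    by (simp add: g_def[abs_def] g'_def c_def)
  have g_filtr: "g z \<in> filtr smul V N" if "z \<in> S" for z
    using pow_L0_filtr[OF filtr(1)[OF that]] by (simp add: g_def)
  have "L 0 (g \<tau>) \<in> filtr smul V N"
    using filtr_graded_map[OF linear_L0, of 0] g_filtr[OF S(2)] L0_grade
    by (simp add: subspace_scale subspace_grade)
  hence g'_filtr: "g' \<in> filtr smul V N"
    unfolding g'_def using pow_L0_filtr[OF filtr(2)]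
    by (intro subspace_add subspace_scale subspace_filtr)
  obtain n where n: "\<And>v. v \<in> filtr smul V N \<Longrightarrow> (L 1 ^^ n) v = 0"
    using L1_uniformly_nilpotent[of N] by metis
  have "(?x has_field_derivative - c * c) (at \<tau>)"
    unfolding c_def by (auto intro!: derivative_eq_intros autj_has_derivative)
  hence "weak_derivative smul (\<lambda>z. exp_op smul (?x z) (L 1) (g z))
      (smul (- c * c) (L 1 u) + exp_op smul (?x \<tau>) (L 1) g') \<tau>"
    unfolding u_def
    by (rule weak_derivative_exp_op[OF linear_L1 _ g S n[OF g_filtr] n[OF g'_filtr]])
  also have "(\<lambda>z. exp_op smul (?x z) (L 1) (g z)) = (\<lambda>z. autK smul V L \<gamma> z (f z))"
    by (simp add: g_def autK_def c_def)
  also have "exp_op smul (?x \<tau>) (L 1) g' =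
      smul (- 2 * c / ?j) (L 0 u + smul (?x \<tau>) (L 1 u)) + autK smul V L \<gamma> \<tau> f'"
    unfolding g'_def E.add E.scale exp_op_L0 by (simp add: u_def autK_def c_def)
  also have "smul (- c * c) (L 1 u) + (smul (- 2 * c / ?j) (L 0 u + smul (?x \<tau>) (L 1 u))
        + autK smul V L \<gamma> \<tau> f')
      = smul (- c * c + - 2 * c / ?j * ?x \<tau>) (L 1 u) + smul (- 2 * c / ?j) (L 0 u)
        + autK smul V L \<gamma> \<tau> f'"
    by (simp only: scale_right_distrib scale_left_distrib scale_scale add_ac)
  also have "- c * c + - 2 * c / ?j * ?x \<tau> = c\<^sup>2"
    using j by (simp add: power2_eq_square field_simps)
  finally show ?thesis by (simp add: u)
qed

lemma autK_Lm1:
  fixes \<gamma> :: "real^2^2"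
  defines "c \<equiv> complex_of_real (\<gamma>$2$1)"
  assumes j: "autj \<gamma> \<tau> \<noteq> 0"
  shows "smul ((autj \<gamma> \<tau>)\<^sup>2) (autK smul V L \<gamma> \<tau> (L (-1) v)) =
    L (-1) (autK smul V L \<gamma> \<tau> v) - smul (2 * c * autj \<gamma> \<tau>) (L 0 (autK smul V L \<gamma> \<tau> v))
      + smul (c\<^sup>2 * (autj \<gamma> \<tau>)\<^sup>2) (L 1 (autK smul V L \<gamma> \<tau> v))"
proof -
  let ?j = "autj \<gamma> \<tau>" and ?x = "- c * autj \<gamma> \<tau>"
  interpret E: Vector_Spaces.linear smul smul "exp_op smul ?x (L 1)" by (rule linear_exp_L1)
  have "autK smul V L \<gamma> \<tau> (L (-1) v)
      = smul (?j powi (-2)) (exp_op smul ?x (L 1) (L (-1) (pow_L0 smul V ?j (-2) v)))"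
    unfolding autK_def pow_L0_Lm1[OF j] c_def[symmetric] by (rule E.scale)
  moreover have "?j\<^sup>2 * ?j powi (-2) = 1"
    using j by (simp add: power_int_minus)
  ultimately have "smul (?j\<^sup>2) (autK smul V L \<gamma> \<tau> (L (-1) v))
      = exp_op smul ?x (L 1) (L (-1) (pow_L0 smul V ?j (-2) v))"
    by simp
  thus ?thesis
    unfolding exp_op_Lm1 by (simp add: autK_def c_def power_mult_distrib mult.assoc)
qed

lemma moebius_has_derivative:
  assumes "det \<gamma> = 1" "autj \<gamma> \<tau> \<noteq> 0"
  shows "(moebius \<gamma> has_field_derivative 1 / (autj \<gamma> \<tau>)\<^sup>2) (at \<tau>)"
proof -
  have "complex_of_real (\<gamma>$1$1) * of_real (\<gamma>$2$2) - of_real (\<gamma>$1$2) * of_real (\<gamma>$2$1) = 1"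
    using assms(1) by (simp add: det_2 flip: of_real_mult of_real_diff)
  hence "of_real (\<gamma>$1$1) * autj \<gamma> \<tau> - (of_real (\<gamma>$1$1) * \<tau> + of_real (\<gamma>$1$2)) * of_real (\<gamma>$2$1) = 1"
    by (simp add: autj_def algebra_simps)
  thus ?thesis
    using assms(2) unfolding moebius_def[abs_def] autj_def
    by (auto intro!: derivative_eq_intros simp: power2_eq_square)
qed

text \<open>
  The lemma allows different functions on the two sides of the transformation law. For an element of the
  group both are the same section; at a cusp \<open>g\<close> is the expansion of \<open>f\<close> after transport.
\<close>

lemma nabla_covariance:
  assumes det: "det \<gamma> = 1" and j: "autj \<gamma> \<tau> \<noteq> 0"
    and f: "weak_derivative smul f f' (moebius \<gamma> \<tau>)"
    and g: "weak_derivative smul g g' \<tau>" and S: "open S" "\<tau> \<in> S"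
    and filtr: "\<And>z. z \<in> S \<Longrightarrow> g z \<in> filtr smul V N" "g' \<in> filtr smul V N"
    and eq: "\<And>z. z \<in> S \<Longrightarrow> f (moebius \<gamma> z) = autK smul V L \<gamma> z (g z)"
  shows "f' + L (-1) (f (moebius \<gamma> \<tau>))
    = smul ((autj \<gamma> \<tau>)\<^sup>2) (autK smul V L \<gamma> \<tau> (g' + L (-1) (g \<tau>)))"
proof -
  let ?j = "autj \<gamma> \<tau>" and ?c = "complex_of_real (\<gamma>$2$1)"
  interpret K: Vector_Spaces.linear smul smul "autK smul V L \<gamma> \<tau>" by (rule linear_autK)
  define u where "u = autK smul V L \<gamma> \<tau> (g \<tau>)"
  have "weak_derivative smul (\<lambda>z. f (moebius \<gamma> z)) (smul (1 / ?j\<^sup>2) f') \<tau>"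
    by (rule weak_derivative_chain[OF f moebius_has_derivative[OF det j]])
  hence "weak_derivative smul (\<lambda>z. autK smul V L \<gamma> z (g z)) (smul (1 / ?j\<^sup>2) f') \<tau>"
    by (rule weak_derivative_transform[OF _ S eq])
  hence "smul (1 / ?j\<^sup>2) f' =
      smul (?c\<^sup>2) (L 1 u) - smul (2 * ?c / ?j) (L 0 u) + autK smul V L \<gamma> \<tau> g'"
    unfolding u_def using weak_derivative_autK[OF j g S filtr] by (rule weak_derivative_unique)
  hence "smul (?j\<^sup>2) (smul (1 / ?j\<^sup>2) f') =
      smul (?j\<^sup>2) (smul (?c\<^sup>2) (L 1 u) - smul (2 * ?c / ?j) (L 0 u) + autK smul V L \<gamma> \<tau> g')"
    by simp
  moreover have "?j\<^sup>2 * (2 * ?c / ?j) = 2 * ?c * ?j" using j by (simp add: power2_eq_square)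
  ultimately have "f' = smul (?c\<^sup>2 * ?j\<^sup>2) (L 1 u) - smul (2 * ?c * ?j) (L 0 u)
      + smul (?j\<^sup>2) (autK smul V L \<gamma> \<tau> g')"
    using j by (simp add: scale_right_distrib scale_right_diff_distrib mult.commute)
  moreover have "f (moebius \<gamma> \<tau>) = u" using eq[OF S(2)] by (simp add: u_def)
  ultimately show ?thesis
    using autK_Lm1[OF j, of "g \<tau>"] by (simp add: K.add scale_right_distrib u_def)
qed

end

section \<open>Fractional linear transformations and preimages of open sets\<close>

lemma autj_nonzero:
  assumes "det \<gamma> = 1" "\<tau> \<in> upper_half_plane"
  shows "autj \<gamma> \<tau> \<noteq> 0"
proof
  assume "autj \<gamma> \<tau> = 0"
  hence "\<gamma>$2$1 * Im \<tau> = 0" "\<gamma>$2$1 * Re \<tau> + \<gamma>$2$2 = 0"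
    by (auto simp: autj_def complex_eq_iff)
  thus False using assms by (auto simp: upper_half_plane_def det_2)
qed

lemma moebius_mult:
  assumes "autj B z \<noteq> 0"
  shows "moebius (A ** B) z = moebius A (moebius B z)"
    and "autj (A ** B) z = autj A (moebius B z) * autj B z"
proof -
  have entry: "(A ** B)$i$k = A$i$1 * B$1$k + A$i$2 * B$2$k" for i k
    by (simp add: matrix_matrix_mult_def sum_2)
  let ?n = "\<lambda>M z. of_real (M$1$1) * z + of_real (M$1$2) :: complex"
  have B: "moebius B z * autj B z = ?n B z"
    using assms by (simp add: moebius_def autj_def)
  have "autj A (moebius B z) * autj B z = of_real (A$2$1) * (moebius B z * autj B z) + of_real (A$2$2) * autj B z"
    by (simp add: autj_def[of A] algebra_simps)
  thus j: "autj (A ** B) z = autj A (moebius B z) * autj B z"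
    unfolding B by (simp add: autj_def entry algebra_simps)
  have "?n A (moebius B z) * autj B z = of_real (A$1$1) * (moebius B z * autj B z) + of_real (A$1$2) * autj B z"
    by (simp add: algebra_simps)
  hence n: "?n (A ** B) z = ?n A (moebius B z) * autj B z"
    unfolding B by (simp add: autj_def entry algebra_simps)
  have m: "moebius M w = ?n M w / autj M w" for M w by (simp add: moebius_def autj_def)
  show "moebius (A ** B) z = moebius A (moebius B z)"
    unfolding m[of "A ** B"] m[of A] n j using assms by simp
qed

lemma moebius_upper_half_plane:
  assumes "det \<gamma> = 1" "\<tau> \<in> upper_half_plane"
  shows "moebius \<gamma> \<tau> \<in> upper_half_plane"
proof -
  let ?n = "of_real (\<gamma>$1$1) * \<tau> + of_real (\<gamma>$1$2)"
  have "Im (?n * cnj (autj \<gamma> \<tau>)) = det \<gamma> * Im \<tau>"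
    by (simp add: autj_def det_2 algebra_simps)
  hence "Im (moebius \<gamma> \<tau>) = Im \<tau> / (cmod (autj \<gamma> \<tau>))\<^sup>2"
    using assms(1) by (simp add: moebius_def autj_def[symmetric] Im_complex_div_eq_0 complex_div_cnj[of ?n])
  thus ?thesis
    using assms autj_nonzero[OF assms] by (simp add: upper_half_plane_def)
qed

lemma lifts_det:
  assumes "subgroup \<Gamma> PSL2R" "\<gamma> \<in> \<Union>\<Gamma>"
  shows "det \<gamma> = 1"
proof -
  obtain C where "C \<in> \<Gamma>" "\<gamma> \<in> C" using assms(2) by blast
  hence "C \<in> carrier PSL2R" using subgroup.subset[OF assms(1)] by blast
  moreover have "det (- mat 1 :: real^2^2) = 1" by (simp add: det_2 mat_def)
  ultimately show ?thesis
    using \<open>\<gamma> \<in> C\<close> by (auto simp: PSL2R_def carrier_FactGroup SL2R_def r_coset_def det_mul)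
qed

lemma lifts_mult:
  assumes "subgroup \<Gamma> PSL2R" "\<gamma> \<in> \<Union>\<Gamma>" "\<delta> \<in> \<Union>\<Gamma>"
  shows "\<gamma> ** \<delta> \<in> \<Union>\<Gamma>"
proof -
  obtain C D where CD: "C \<in> \<Gamma>" "\<gamma> \<in> C" "D \<in> \<Gamma>" "\<delta> \<in> D" using assms(2,3) by blast
  hence "C <#>\<^bsub>SL2R\<^esub> D \<in> \<Gamma>"
    using subgroup.m_closed[OF assms(1)] by (simp add: PSL2R_def)
  moreover have "\<gamma> ** \<delta> \<in> C <#>\<^bsub>SL2R\<^esub> D"
    using CD by (auto simp: set_mult_def SL2R_def)
  ultimately show ?thesis by blast
qed

lemma moebius_sphere_real:
  "x \<in> insert None (Some ` \<real>) \<Longrightarrow> moebius_sphere \<gamma> x \<in> insert None (Some ` \<real>)"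
  by (auto simp: moebius_def intro!: Reals_divide Reals_add Reals_mult split: if_splits)

text \<open>
  An open subset of the curve is a set of orbits, so its preimage is stable under the group. The base
  point of an orbit that meets the half plane cannot be a cusp, since real points and \<open>\<infinity>\<close> stay real or
  infinite; so the composition law is applied at points of the half plane.
\<close>

lemma moebius_preim:
  assumes \<Gamma>: "subgroup \<Gamma> PSL2R" and U: "curve_open \<Gamma> U"
    and \<gamma>: "\<gamma> \<in> \<Union>\<Gamma>" and \<tau>: "\<tau> \<in> preim U"
  shows "moebius \<gamma> \<tau> \<in> preim U"
proof -
  have H: "\<tau> \<in> upper_half_plane" using \<tau> by (simp add: preim_def)
  obtain O' where O': "O' \<in> U" "Some \<tau> \<in> O'" using \<tau> by (auto simp: preim_def)
  obtain x where x: "x \<in> extended_half_plane \<Gamma>"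
    and O'_eq: "O' = (\<lambda>\<gamma>. moebius_sphere \<gamma> x) ` (\<Union>\<Gamma>)"
    using O'(1) U by (auto simp: curve_open_def modular_curve_def)
  obtain \<delta> where \<delta>: "\<delta> \<in> \<Union>\<Gamma>" "moebius_sphere \<delta> x = Some \<tau>"
    using O'(2) unfolding O'_eq by force
  have "x \<notin> insert None (Some ` \<real>)"
  proof
    assume "x \<in> insert None (Some ` \<real>)"
    hence "Some \<tau> \<in> insert None (Some ` \<real>)"
      using moebius_sphere_real[of x \<delta>] \<delta>(2) by simp
    thus False using H by (auto simp: upper_half_plane_def complex_is_Real_iff)
  qed
  then obtain z where z: "x = Some z" "z \<in> upper_half_plane"
    using x by (auto simp: extended_half_plane_def cusps_def)
  note det = lifts_det[OF \<Gamma>]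
  have j: "autj M w \<noteq> 0" if "M \<in> \<Union>\<Gamma>" "w \<in> upper_half_plane" for M w
    using autj_nonzero[OF det] that by blast
  have sphere: "moebius_sphere M (Some w) = Some (moebius M w)"
    if "M \<in> \<Union>\<Gamma>" "w \<in> upper_half_plane" for M w
    using j[OF that] by (simp add: autj_def)
  have "moebius \<delta> z = \<tau>" using \<delta> sphere[OF \<delta>(1) z(2)] z(1) by simp
  hence "moebius (\<gamma> ** \<delta>) z = moebius \<gamma> \<tau>" by (simp add: moebius_mult j[OF \<delta>(1) z(2)])
  moreover have mult: "\<gamma> ** \<delta> \<in> \<Union>\<Gamma>" by (rule lifts_mult[OF \<Gamma> \<gamma> \<delta>(1)])
  ultimately have "Some (moebius \<gamma> \<tau>) = moebius_sphere (\<gamma> ** \<delta>) x"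
    using sphere[OF mult z(2)] z(1) by simp
  hence "Some (moebius \<gamma> \<tau>) \<in> O'" unfolding O'_eq using mult by blast
  thus ?thesis
    using O'(1) moebius_upper_half_plane[OF det[OF \<gamma>] H] by (auto simp: preim_def)
qed

lemma open_preim: "curve_open \<Gamma> U \<Longrightarrow> open (preim U)"
  by (simp add: curve_open_def extended_half_plane_open_def preim_def)

lemma preim_mono: "U' \<subseteq> U \<Longrightarrow> preim U' \<subseteq> preim U"
  by (auto simp: preim_def)

section \<open>Sections\<close>

lemma qexp_has_derivative:
  "(qexp \<omega> has_field_derivative 2 * of_real pi * \<i> / of_real \<omega> * qexp \<omega> \<tau>) (at \<tau>)"
  unfolding qexp_def[abs_def] by (cases "\<omega> = 0") (auto intro!: derivative_eq_intros)

context qvoa begin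

lemma section_weak_derivative:
  assumes "f \<in> aut_sections smul (filtr smul V N) M \<Gamma> U" "curve_open \<Gamma> U" "\<tau> \<in> preim U"
  shows "weak_derivative smul f (vderiv smul f \<tau>) \<tau>" "vderiv smul f \<tau> \<in> filtr smul V N"
proof -
  obtain B where "finite B" "filtr smul V N = span B" using filtr_finite_dim[of N] by metis
  thus "weak_derivative smul f (vderiv smul f \<tau>) \<tau>" "vderiv smul f \<tau> \<in> filtr smul V N"
    using holo_into_weak_derivative[of B "preim U" f \<tau>] assms open_preim
    by (auto simp: aut_sections_def)
qed

lemma bundle_section_weak_derivative:
  assumes "f \<in> bundle_sections smul V L \<Gamma> U" "curve_open \<Gamma> U" "\<tau> \<in> preim U"
  shows "weak_derivative smul f (vderiv smul f \<tau>) \<tau>"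
  using assms section_weak_derivative(1) unfolding bundle_sections_def by blast

text \<open>
  Used with \<open>c = 1\<close> in the coordinate \<open>\<tau>\<close>, and with \<open>c = (2\<pi>i/\<omega>) q\<close> in the coordinate \<open>q\<close>, where
  \<open>d/d\<tau> = (2\<pi>i/\<omega>) q d/dq\<close>.
\<close>

lemma holo_into_nabla:
  assumes c: "c holomorphic_on S" and f: "holo_into smul (filtr smul V N) S f" and S: "open S"
  shows "holo_into smul (filtr smul V (N + 1)) S (\<lambda>z. smul (c z) (vderiv smul f z) + L (-1) (f z))"
proof (rule holo_into_add[OF _ _ subspace_filtr])
  obtain B where "finite B" "filtr smul V N = span B" using filtr_finite_dim[of N] by metis
  hence "holo_into smul (filtr smul V N) S (vderiv smul f)"
    using f S holo_into_vderiv by simp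
  hence "holo_into smul (filtr smul V (N + 1)) S (vderiv smul f)"
    by (rule holo_into_mono) (simp add: filtr_mono)
  thus "holo_into smul (filtr smul V (N + 1)) S (\<lambda>z. smul (c z) (vderiv smul f z))"
    by (rule holo_into_smul[OF c _ subspace_filtr])
  show "holo_into smul (filtr smul V (N + 1)) S (\<lambda>z. L (-1) (f z))"
    using filtr_graded_map[OF linear_Lm1 Lm1_grade]
    by (intro holo_into_linear[OF linear_Lm1 f]) blast
qed

text \<open>
  Both the transformation law and the expansion at a cusp \<open>\<sigma>\<infinity>\<close> are instances of
  \<open>nabla_covariance\<close>. At the cusp the new expansion acquires the factor \<open>q\<close> from differentiating the
  exponential, so it stays holomorphic at \<open>q = 0\<close> on the same disc.
\<close>

lemma nabla_section:
  assumes \<Gamma>: "subgroup \<Gamma> PSL2R" and U: "curve_open \<Gamma> U"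
    and f: "f \<in> aut_sections smul (filtr smul V N) (autK smul V L) \<Gamma> U"
  shows "nabla smul L U f \<in> aut_sections smul (filtr smul V (N + 1))
    (\<lambda>\<gamma> \<tau> v. smul ((autj \<gamma> \<tau>)\<^sup>2) (autK smul V L \<gamma> \<tau> v)) \<Gamma> U"
proof -
  have f_holo: "holo_into smul (filtr smul V N) (preim U) f"
    and f_aut: "\<And>\<gamma> \<tau>. \<gamma> \<in> \<Union>\<Gamma> \<Longrightarrow> \<tau> \<in> preim U \<Longrightarrow> f (moebius \<gamma> \<tau>) = autK smul V L \<gamma> \<tau> (f \<tau>)"
    and f_cusp: "\<And>\<sigma> \<omega>. det \<sigma> = 1 \<Longrightarrow> moebius_sphere \<sigma> None \<in> \<Union>U \<Longrightarrow> cusp_width \<Gamma> \<sigma> \<omega> \<Longrightarrow>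
        \<exists>r>0. \<exists>h. holo_into smul (filtr smul V N) (ball 0 r) h \<and>
           (\<forall>\<tau>\<in>upper_half_plane. qexp \<omega> \<tau> \<in> ball 0 r \<longrightarrow>
              moebius \<sigma> \<tau> \<in> preim U \<and> f (moebius \<sigma> \<tau>) = autK smul V L \<sigma> \<tau> (h (qexp \<omega> \<tau>)))"
    using f by (auto simp: aut_sections_def)
  note openU = open_preim[OF U]
  have H: "\<tau> \<in> upper_half_plane" if "\<tau> \<in> preim U" for \<tau> using that by (simp add: preim_def)
  have holo: "holo_into smul (filtr smul V (N + 1)) (preim U) (nabla smul L U f)"
    by (rule holo_into_cong[OF holo_into_nabla[OF holomorphic_on_const[of 1] f_holo openU]])
      (simp add: nabla_def)
  have aut: "nabla smul L U f (moebius \<gamma> \<tau>)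
      = smul ((autj \<gamma> \<tau>)\<^sup>2) (autK smul V L \<gamma> \<tau> (nabla smul L U f \<tau>))"
    if \<gamma>: "\<gamma> \<in> \<Union>\<Gamma>" and \<tau>: "\<tau> \<in> preim U" for \<gamma> \<tau>
  proof -
    have \<gamma>\<tau>: "moebius \<gamma> \<tau> \<in> preim U" by (rule moebius_preim[OF \<Gamma> U \<gamma> \<tau>])
    have det: "det \<gamma> = 1" by (rule lifts_det[OF \<Gamma> \<gamma>])
    have f_filtr: "f z \<in> filtr smul V N" if "z \<in> preim U" for z
      using f_holo that by (auto simp: holo_into_def)
    have "vderiv smul f (moebius \<gamma> \<tau>) + L (-1) (f (moebius \<gamma> \<tau>))
        = smul ((autj \<gamma> \<tau>)\<^sup>2) (autK smul V L \<gamma> \<tau> (vderiv smul f \<tau> + L (-1) (f \<tau>)))"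
      by (rule nabla_covariance[OF det autj_nonzero[OF det H[OF \<tau>]]
            section_weak_derivative(1)[OF f U \<gamma>\<tau>] section_weak_derivative(1)[OF f U \<tau>]
            openU \<tau> f_filtr section_weak_derivative(2)[OF f U \<tau>] f_aut[OF \<gamma>]])
    thus ?thesis using \<tau> \<gamma>\<tau> by (simp add: nabla_def)
  qed
  have cusp: "\<exists>r>0. \<exists>h. holo_into smul (filtr smul V (N + 1)) (ball 0 r) h \<and>
       (\<forall>\<tau>\<in>upper_half_plane. qexp \<omega> \<tau> \<in> ball 0 r \<longrightarrow> moebius \<sigma> \<tau> \<in> preim U \<and>
          nabla smul L U f (moebius \<sigma> \<tau>) =
            smul ((autj \<sigma> \<tau>)\<^sup>2) (autK smul V L \<sigma> \<tau> (h (qexp \<omega> \<tau>))))"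
    if \<sigma>: "det \<sigma> = 1" and s: "moebius_sphere \<sigma> None \<in> \<Union>U" and \<omega>: "cusp_width \<Gamma> \<sigma> \<omega>" for \<sigma> \<omega>
  proof -
    obtain r h where r: "r > 0" and h: "holo_into smul (filtr smul V N) (ball 0 r) h"
      and fh: "\<And>\<tau>. \<tau> \<in> upper_half_plane \<Longrightarrow> qexp \<omega> \<tau> \<in> ball 0 r \<Longrightarrow>
              moebius \<sigma> \<tau> \<in> preim U \<and> f (moebius \<sigma> \<tau>) = autK smul V L \<sigma> \<tau> (h (qexp \<omega> \<tau>))"
      using f_cusp[OF \<sigma> s \<omega>] by blast
    let ?a = "2 * of_real pi * \<i> / of_real \<omega> :: complex"
    \<comment> \<open>The expansion of \<open>\<nabla> f\<close> at the cusp; \<open>?a * q\<close> is \<open>dq/d\<tau>\<close>.\<close>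
    define h' where "h' q = smul (?a * q) (vderiv smul h q) + L (-1) (h q)" for q
    have h'_holo: "holo_into smul (filtr smul V (N + 1)) (ball 0 r) h'"
      unfolding h'_def[abs_def]
      by (rule holo_into_nabla[OF _ h]) (auto intro!: holomorphic_intros)
    define S where "S = upper_half_plane \<inter> qexp \<omega> -` ball 0 r"
    have "open upper_half_plane"
      unfolding upper_half_plane_def by (rule open_halfspace_Im_gt)
    moreover have "continuous_on UNIV (qexp \<omega>)"
      using qexp_has_derivative DERIV_isCont continuous_at_imp_continuous_on by blast
    ultimately have openS: "open S"
      unfolding S_def by (intro open_Int open_vimage) auto
    obtain B where B: "finite B" "filtr smul V N = span B" using filtr_finite_dim[of N] by metis
    have "moebius \<sigma> \<tau> \<in> preim U \<and> nabla smul L U f (moebius \<sigma> \<tau>) =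
            smul ((autj \<sigma> \<tau>)\<^sup>2) (autK smul V L \<sigma> \<tau> (h' (qexp \<omega> \<tau>)))"
      if \<tau>: "\<tau> \<in> upper_half_plane" "qexp \<omega> \<tau> \<in> ball 0 r" for \<tau>
    proof
      let ?q = "qexp \<omega> \<tau>"
      show \<sigma>\<tau>: "moebius \<sigma> \<tau> \<in> preim U" using fh[OF \<tau>] by blast
      have h_deriv: "weak_derivative smul h (vderiv smul h ?q) ?q"
        and mem: "vderiv smul h ?q \<in> span B"
        using holo_into_weak_derivative[OF h[unfolded B(2)] B(1) _ \<tau>(2)] by auto
      have hq: "weak_derivative smul (\<lambda>\<tau>. h (qexp \<omega> \<tau>)) (smul (?a * ?q) (vderiv smul h ?q)) \<tau>"
        by (rule weak_derivative_chain[OF h_deriv qexp_has_derivative])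
      have mem': "smul (?a * ?q) (vderiv smul h ?q) \<in> filtr smul V N"
        unfolding B(2) by (rule span_scale[OF mem])
      have \<tau>S: "\<tau> \<in> S" using \<tau> by (simp add: S_def)
      have h_filtr: "h (qexp \<omega> z) \<in> filtr smul V N" if "z \<in> S" for z
        using h that by (auto simp: holo_into_def S_def)
      have f_eq: "f (moebius \<sigma> z) = autK smul V L \<sigma> z (h (qexp \<omega> z))" if "z \<in> S" for z
        using fh that by (simp add: S_def)
      have "vderiv smul f (moebius \<sigma> \<tau>) + L (-1) (f (moebius \<sigma> \<tau>))
          = smul ((autj \<sigma> \<tau>)\<^sup>2) (autK smul V L \<sigma> \<tau>
              (smul (?a * ?q) (vderiv smul h ?q) + L (-1) (h ?q)))"
        by (rule nabla_covariance[OF \<sigma> autj_nonzero[OF \<sigma> \<tau>(1)]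
              section_weak_derivative(1)[OF f U \<sigma>\<tau>] hq openS \<tau>S h_filtr mem' f_eq])
      thus "nabla smul L U f (moebius \<sigma> \<tau>) = smul ((autj \<sigma> \<tau>)\<^sup>2) (autK smul V L \<sigma> \<tau> (h' ?q))"
        using \<sigma>\<tau> by (simp add: nabla_def h'_def)
    qed
    with r h'_holo show ?thesis by blast
  qed
  have "nabla smul L U f \<in> extensional (preim U)" by (simp add: nabla_def)
  with holo aut cusp show ?thesis unfolding aut_sections_def by blast
qed

lemma nabla_eqI:
  assumes "\<And>\<tau>. \<tau> \<in> preim U \<Longrightarrow> weak_derivative smul f (f' \<tau>) \<tau>"
    and "\<And>\<tau>. \<tau> \<in> preim U \<Longrightarrow> f' \<tau> + L (-1) (f \<tau>) = g \<tau>"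
  shows "nabla smul L U f = (\<lambda>\<tau>\<in>preim U. g \<tau>)"
  unfolding nabla_def by (intro restrict_ext) (simp add: vderiv_eq[OF assms(1)] assms(2))

end

theorem theoremB:
  fixes smul :: "complex \<Rightarrow> 'v::ab_group_add \<Rightarrow> 'v"
    and Y :: "'v \<Rightarrow> int \<Rightarrow> 'v \<Rightarrow> 'v" and vac :: 'v
    and V :: "int \<Rightarrow> 'v set" and L :: "int \<Rightarrow> 'v \<Rightarrow> 'v"
    and \<Gamma> :: "(real^2^2) set set"
  assumes "qvoa smul Y vac V L"
    and "fuchsian_first_kind \<Gamma>"
  shows "is_connection smul \<Gamma> (bundle_sections smul V L \<Gamma>)
           (bundle_form_sections smul V L \<Gamma>) (nabla smul L)"
proof -
  interpret qvoa smul Y vac V L by fact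
  have \<Gamma>: "subgroup \<Gamma> PSL2R" using assms(2) by (simp add: fuchsian_first_kind_def)
  show ?thesis
    unfolding is_connection_def
  proof (intro allI impI conjI ballI)
    fix U assume U: "curve_open \<Gamma> U"
    let ?E = "bundle_sections smul V L \<Gamma> U"
    note deriv = bundle_section_weak_derivative[OF _ U]
    have local: "weak_derivative smul (restrict g (preim W)) v \<tau>"
      if "curve_open \<Gamma> W" "\<tau> \<in> preim W" "weak_derivative smul g v \<tau>" for W g v \<tau>
      by (rule weak_derivative_transform[OF that(3) open_preim[OF that(1)] that(2)]) simp
    show "nabla smul L U \<in> ?E \<rightarrow> bundle_form_sections smul V L \<Gamma> U"
      unfolding bundle_sections_def bundle_form_sections_def using nabla_section[OF \<Gamma> U] by blast
    {
      fix U' f assume *: "curve_open \<Gamma> U' \<and> U' \<subseteq> U \<and> f \<in> ?E"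
      hence sub: "preim U' \<subseteq> preim U" by (intro preim_mono) auto
      have "nabla smul L U' (restrict f (preim U'))
          = (\<lambda>\<tau>\<in>preim U'. vderiv smul f \<tau> + L (-1) (f \<tau>))"
        using * sub by (intro nabla_eqI[where f' = "vderiv smul f"] local deriv) auto
      also have "\<dots> = restrict (nabla smul L U f) (preim U')"
        using sub by (intro restrict_ext) (auto simp: nabla_def)
      finally show "nabla smul L U' (restrict f (preim U')) = restrict (nabla smul L U f) (preim U')" .
    next
      fix f g assume fg: "f \<in> ?E" "g \<in> ?E"
      show "nabla smul L U (\<lambda>\<tau>\<in>preim U. f \<tau> + g \<tau>)
          = (\<lambda>\<tau>\<in>preim U. nabla smul L U f \<tau> + nabla smul L U g \<tau>)"
        by (rule nabla_eqI[OF local[OF U _ weak_derivative_add[OF deriv[OF fg(1)] deriv[OF fg(2)]]]])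
          (auto simp: nabla_def Lm1.add)
    next
      fix a f assume f: "f \<in> ?E"
      show "nabla smul L U (\<lambda>\<tau>\<in>preim U. smul a (f \<tau>)) = (\<lambda>\<tau>\<in>preim U. smul a (nabla smul L U f \<tau>))"
        by (rule nabla_eqI[OF local[OF U _ weak_derivative_linear[OF linear_scale_self deriv[OF f]]]])
          (auto simp: nabla_def Lm1.scale scale_right_distrib)
    next
      fix h f assume h: "h \<in> structure_sheaf \<Gamma> U" and f: "f \<in> ?E"
      have "holo_into (*) UNIV (preim U) h"
        using h by (simp add: structure_sheaf_def aut_sections_def)
      hence h_holo: "h holomorphic_on preim U"
        using vector_space_over_itself.linear_ident by (auto simp: holo_into_def)
      have h': "(h has_field_derivative deriv h \<tau>) (at \<tau>)" if "\<tau> \<in> preim U" for \<tau>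
        by (rule holomorphic_derivI[OF h_holo open_preim[OF U] that])
      show "nabla smul L U (\<lambda>\<tau>\<in>preim U. smul (h \<tau>) (f \<tau>)) =
          (\<lambda>\<tau>\<in>preim U. smul (deriv h \<tau>) (f \<tau>) + smul (h \<tau>) (nabla smul L U f \<tau>))"
        by (rule nabla_eqI[OF local[OF U _ weak_derivative_smul[OF h' deriv[OF f]]]])
          (auto simp: nabla_def Lm1.scale scale_right_distrib add.assoc)
    }
  qed
qed

end
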